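(* Let $n\ge 2$ and let $\mathcal{X}^{(n)}=\sum_{i=1}^n\delta_{P_i}$ be the spherical ensemble on $\mathbb{S}^2$. Let $\gamma$ be the Euler constant. Then: (i) (Logarithmic energy) \[\mathbf{E}\,E_{\log}(P_1,\ldots,P_n)=\left(\frac12-\log 2\right)n^2-\frac12 n\log n+\left(\log 2-\frac{\gamma}{2}\right)n-\frac14+O\left(\frac1n\right)\quad (n\to\infty).\] (ii) (Riesz $s$-energy, $s<4$ and $s\neq 2$) \[\mathbf{E}\,E_{s}(P_1,\ldots,P_n)=\frac{2^{1-s}}{2-s}n^2-\frac{\Gamma(n)\Gamma(1-s/2)}{2^{s}\,\Gamma(n+1-s/2)}n^2.\] (iii) (Riesz $2$-energy) \[\mathbf{E}\,E_{2}(P_1,\ldots,P_n)=\frac14 n^2\log n+\frac{\gamma}{4}n^2-\frac n8-\frac1{48}+O\left(\frac1{n^2}\right)\quad (n\to\infty).\]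
   Context: Spherical ensemble. Let $\mathbb{S}^2=\{p\in\mathbb{R}^3:|p|=1\}$ and let $\nu$ be the surface area measure on $\mathbb{S}^2$ (total mass $4\pi$). Let $A_n,B_n$ be independent $n\times n$ random matrices with i.i.d. standard complex Gaussian entries, let $\lambda_1,\ldots,\lambda_n$ be the eigenvalues of $A_n^{-1}B_n$, let $g$ be the stereographic projection of $\mathbb{S}^2$ from the north pole onto the plane $\{(t_1,t_2,0)\}\cong\mathbb{C}$, and let $P_i=g^{-1}(\lambda_i)$. Equivalently, in uniform random order, $(P_1,\ldots,P_n)$ has joint density proportional to $\prod_{i<j}|p_i-p_j|^2$ with respect to $\nu^{\otimes n}$ on $(\mathbb{S}^2)^n$, where $|\cdot|$ is the Euclidean norm. The point process is $\mathcal{X}^{(n)}=\sum_{i=1}^n\delta_{P_i}$. Energies. For points $x_1,\ldots,x_n\in\mathbb{S}^2$ and real $s$, \[E_{\log}(x_1,\ldots,x_n)=\sum_{i\ne j}\log\frac1{|x_i-x_j|},\qquad E_s(x_1,\ldots,x_n)=\sum_{i\neq j}\frac{1}{|x_i-x_j|^s},\] the sums being over ordered pairs $(i,j)$ with $i\ne j$. *)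

theory Defs
  imports "HOL-Probability.Probability"
begin

abbreviation S2 :: "(real ^ 3) set" where
  "S2 \<equiv> sphere 0 1"

definition sphere_borel :: "(real ^ 3) measure" where
  "sphere_borel = restrict_space borel S2"

text \<open>Colatitude and longitude. The parametrization is injective on
  \<open>{0<..<pi} \<times> {0..<2 * pi}\<close> and misses only the two poles.\<close>

definition sph_coords :: "real \<times> real \<Rightarrow> real ^ 3" where
  "sph_coords = (\<lambda>(\<theta>, \<phi>). vector [sin \<theta> * cos \<phi>, sin \<theta> * sin \<phi>, cos \<theta>])"

text \<open>Surface area on the sphere: the area element of the parametrization is the norm of the
  cross product of its two partial derivatives, which is \<open>sin \<theta>\<close>.\<close>

definition sphere_area :: "(real ^ 3) measure" where
  "sphere_area =
     distr (density lborel
              (\<lambda>(\<theta>, \<phi>). ennreal (indicator ({0<..<pi} \<times> {0..<2 * pi}) (\<theta>, \<phi>) * sin \<theta>)))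
       sphere_borel sph_coords"

lemma sph_coords_in_S2: "sph_coords x \<in> S2"
proof -
  obtain a b where x: "x = (a, b)" by (cases x)
  have "(cos a)\<^sup>2 + ((cos b)\<^sup>2 * (sin a)\<^sup>2 + (sin a)\<^sup>2 * (sin b)\<^sup>2)
      = (cos a)\<^sup>2 + (sin a)\<^sup>2 * ((cos b)\<^sup>2 + (sin b)\<^sup>2)"
    by (simp only: distrib_left mult.commute)
  also have "\<dots> = 1" by simp
  finally show ?thesis
    by (simp add: x sph_coords_def norm_vec_def L2_set_def sum_3 power_mult_distrib
          algebra_simps)
qed

lemma measurable_sph_coords: "sph_coords \<in> lborel \<rightarrow>\<^sub>M sphere_borel"
proof -
  have "sph_coords \<in> borel \<rightarrow>\<^sub>M borel"
  proof (rule borel_measurable_continuous_onI)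
    have "continuous_on UNIV (\<lambda>x. sph_coords x $ i)" for i
      using exhaust_3[of i]
      by (elim disjE; simp add: sph_coords_def case_prod_beta) (intro continuous_intros)+
    then have "continuous_on UNIV (\<lambda>x. \<chi> i. sph_coords x $ i)"
      by (intro continuous_on_vec_lambda)
    then show "continuous_on UNIV sph_coords" by simp
  qed
  then have "sph_coords \<in> lborel \<rightarrow>\<^sub>M borel" by simp
  then show ?thesis
    unfolding sphere_borel_def
    using sph_coords_in_S2 by (intro measurable_restrict_space2) blast+
qed

lemma emeasure_sphere_area_space: "emeasure sphere_area S2 = ennreal (4 * pi)"
proof -
  let ?f = "\<lambda>(t, p). indicator ({0<..<pi} \<times> {0..<2 * pi}) (t, p) * sin t :: real"
  have m: "(\<lambda>x. ennreal (?f x)) \<in> borel_measurable (lborel \<Otimes>\<^sub>M lborel)"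
    by measurable
  have S: "S2 \<in> sets sphere_borel"
    by (simp add: sphere_borel_def sets_restrict_space_iff)
  have FTC: "(\<integral>\<^sup>+ t. ennreal (indicator {0<..<pi} t * sin t) \<partial>lborel) = ennreal 2"
  proof -
    have "(\<integral>\<^sup>+ t. ennreal (indicator {0<..<pi} t * sin t) \<partial>lborel)
        = (\<integral>\<^sup>+ t. ennreal (sin t) * indicator {0..pi} t \<partial>lborel)"
      by (intro nn_integral_cong) (auto simp: indicator_def)
    also have "\<dots> = ennreal ((- cos pi) - (- cos 0))"
      by (rule nn_integral_FTC_Icc)
        (auto intro!: derivative_eq_intros sin_ge_zero)
    finally show ?thesis by simp
  qed
  have "emeasure sphere_area S2 = (\<integral>\<^sup>+ x. ennreal (?f x) \<partial>lborel)"
  proof -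
    have V: "sph_coords -` S2 = UNIV" using sph_coords_in_S2 by blast
    have f: "(\<lambda>(\<theta>, \<phi>). ennreal (indicator ({0<..<pi} \<times> {0..<2 * pi}) (\<theta>, \<phi>) * sin \<theta>))
        = (\<lambda>x. ennreal (?f x))"
      by auto
    show ?thesis
      unfolding sphere_area_def f
      using measurable_sph_coords S m
      by (subst emeasure_distr) (simp_all add: V emeasure_density lborel_prod)
  qed
  also have "\<dots> = (\<integral>\<^sup>+ t. \<integral>\<^sup>+ p. ennreal (?f (t, p)) \<partial>lborel \<partial>lborel)"
    using m by (subst lborel_prod[symmetric], subst lborel.nn_integral_fst[symmetric]) auto
  also have "\<dots> = (\<integral>\<^sup>+ t. \<integral>\<^sup>+ p. ennreal (indicator {0<..<pi} t * sin t) * indicator {0..<2 * pi} p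
                    \<partial>lborel \<partial>lborel)"
    by (intro nn_integral_cong) (auto simp: indicator_def)
  also have "\<dots> = (\<integral>\<^sup>+ t. ennreal (indicator {0<..<pi} t * sin t) * ennreal (2 * pi) \<partial>lborel)"
    by (simp add: nn_integral_cmult_indicator)
  also have "\<dots> = ennreal 2 * ennreal (2 * pi)"
    by (subst nn_integral_multc) (auto simp: FTC)
  also have "\<dots> = ennreal (4 * pi)"
    by (subst ennreal_mult[symmetric]) auto
  finally show ?thesis .
qed

text \<open>The points \<open>P 0, \<dots>, P (n - 1)\<close>, listed in any (possibly random) order, form the spherical
  ensemble if the tuple obtained by an independent, uniformly random relabelling \<open>\<sigma>\<close> has joint
  density proportional to the product of the squared mutual distances. The constant \<open>c\<close> is
  determined by the total mass of the law being 1.\<close>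

definition spherical_ensemble :: "nat \<Rightarrow> 'a measure \<Rightarrow> (nat \<Rightarrow> 'a \<Rightarrow> real ^ 3) \<Rightarrow> bool" where
  "spherical_ensemble n M P \<longleftrightarrow>
     prob_space M \<and>
     (\<forall>i<n. P i \<in> M \<rightarrow>\<^sub>M sphere_borel) \<and>
     (\<exists>c::real.
        distr (M \<Otimes>\<^sub>M uniform_count_measure {\<sigma>. \<sigma> permutes {..<n}})
          (Pi\<^sub>M {..<n} (\<lambda>_. sphere_borel))
          (\<lambda>(\<omega>, \<sigma>). \<lambda>i\<in>{..<n}. P (\<sigma> i) \<omega>)
        = density (Pi\<^sub>M {..<n} (\<lambda>_. sphere_area))
            (\<lambda>p. ennreal (c * (\<Prod>j<n. \<Prod>i<j. (norm (p i - p j))\<^sup>2))))"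

text \<open>Coinciding points contribute 0 to these energies by the conventions for
  division by 0, \<^const>\<open>ln\<close> and \<^const>\<open>powr\<close> at 0; this has no effect on expectations, since the points of a
  spherical ensemble are almost surely distinct.\<close>

definition log_energy :: "nat \<Rightarrow> (nat \<Rightarrow> real ^ 3) \<Rightarrow> real" where
  "log_energy n x = (\<Sum>i<n. \<Sum>j\<in>{..<n} - {i}. ln (1 / norm (x i - x j)))"

definition riesz_energy :: "real \<Rightarrow> nat \<Rightarrow> (nat \<Rightarrow> real ^ 3) \<Rightarrow> real" where
  "riesz_energy s n x = (\<Sum>i<n. \<Sum>j\<in>{..<n} - {i}. 1 / norm (x i - x j) powr s)"

end

theory Submission
  imports Defs "HOL-Combinatorics.Permutations" "HOL-Real_Asymp.Real_Asymp"
    "Jordan_Normal_Form.Determinant"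
begin

text \<open>
  Represent \<open>p\<close> on the sphere by a unit spinor \<open>(a, b)\<close> in \<open>\<complex>\<^sup>2\<close>. Then
  \<open>|p - q|\<^sup>2 = 4 |a b' - a' b|\<^sup>2\<close>, so by Vandermonde the density of the ensemble is a multiple of
  \<open>|det (\<phi>\<^sub>k (p\<^sub>i))|\<^sup>2\<close> for the monomials \<open>\<phi>\<^sub>k = a\<^bsup>n-1-k\<^esup> b\<^sup>k\<close>, which are orthogonal for the surface
  area. Expanding both determinants, the law of a pair of points is governed by the kernel
  \<open>(a a' + b cnj b')\<^bsup>n-1\<^esup>\<close>, whose squared modulus is \<open>w\<^bsup>n-1\<^esup>\<close> with \<open>w = 1 - |p - q|\<^sup>2 / 4\<close>. The moments of
  \<open>w\<close> identify its law as the density \<open>n / (n - 1) (1 - w\<^bsup>n-1\<^esup>)\<close> on \<open>[0, 1]\<close>, because a distribution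
  on a bounded interval is determined by its moments. An expected pair energy is therefore a
  one-dimensional integral, equal to a telescoping sum of Beta values for the Riesz energies and to
  an expression in the harmonic number \<open>H\<^sub>n\<close> for the logarithmic energy; the expansion of \<open>H\<^sub>n\<close> up to
  \<open>O(1 / n\<^sup>4)\<close> gives the asymptotics.
\<close>

section \<open>Homogeneous Vandermonde determinant\<close>

text \<open>The energies are unbounded where points meet, while expanding two determinants and
  applying Fubini is painless only for bounded pair functions. The expansion is therefore done for
  the powers of \<open>w\<close> alone; passing through the law of \<open>w\<close> then gives
  integrability and value at once for any function of the distance that is integrable against the
  density of \<open>w\<close>. That density vanishes to first order at \<open>w = 1\<close>, where
  the points coincide. This raises the exponent -s/2 of \<open>1 - w\<close> to 1 - s/2 and explains
  the bound s < 4; at s = 2 the telescoped Beta terms have a pole and the sum is harmonic instead.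
  Monomials in a spinor replace polynomials in the stereographic coordinate because they are bounded
  on the whole sphere, poles included, and bring in no Jacobian of the projection. The density is
  given only up to its constant and only after a random relabelling: the zeroth moment recovers the
  constant, and the relabelling disappears because the energies are symmetric in the points.\<close>

no_notation Matrix.vec_index (infixl "$" 100)
hide_const (open) Determinant.det

lemma det_homogeneous_vandermonde:
  fixes a b :: "nat \<Rightarrow> 'a::idom"
  shows "Determinant.det (mat n n (\<lambda>(i, k). a i ^ (n - 1 - k) * b i ^ k))
       = (\<Prod>j<n. \<Prod>i<j. a i * b j - a j * b i)"
proof (induction n)
  case 0
  then show ?case by (simp add: det_dim_zero)
next
  case (Suc m)
  let ?A = "mat (Suc m) (Suc m) (\<lambda>(i, k). a i ^ (m - k) * b i ^ k)"
  let ?V = "mat m m (\<lambda>(i, k). a i ^ (m - 1 - k) * b i ^ k)"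
  have A: "?A \<in> carrier_mat (Suc m) (Suc m)" by simp
  \<comment> \<open>Both cases below leave the smaller matrix with row i scaled by a factor
    \<open>c i\<close>.\<close>
  have rows: "Determinant.det (mat m m (\<lambda>(i, k). c i * (a i ^ (m - 1 - k) * b i ^ k)))
      = (\<Prod>i<m. c i) * Determinant.det ?V" for c
    by (subst (1 2) det_def'[where n = m])
      (auto simp: prod.distrib sum_distrib_left atLeast0LessThan mult.left_commute permutes_in_image
        intro!: sum.cong)
  have "Determinant.det ?A = (\<Prod>i<m. a i * b m - a m * b i) * Determinant.det ?V"
  proof (cases "a m = 0")
    case True
    have "Determinant.det ?A = (\<Sum>j<Suc m. ?A $$ (m, j) * cofactor ?A m j)"
      by (rule laplace_expansion_row[OF A]) simp
    also have "\<dots> = (\<Sum>j\<in>{m}. ?A $$ (m, j) * cofactor ?A m j)"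
      by (rule sum.mono_neutral_right) (auto simp: True)
    also have "\<dots> = b m ^ m * Determinant.det (mat_delete ?A m m)"
      by (simp add: cofactor_def)
    also have "mat_delete ?A m m = mat m m (\<lambda>(i, k). a i * (a i ^ (m - 1 - k) * b i ^ k))"
      by (rule eq_matI)
        (auto simp: mat_delete_def power_Suc[symmetric] Suc_diff_Suc simp flip: mult.assoc simp del: power_Suc)
    finally show ?thesis
      by (subst (asm) rows) (simp add: True prod.distrib mult_ac)
  next
    case False
    let ?U = "mat (Suc m) (Suc m) (\<lambda>(i, k). if k = 0 then (if i = 0 then 1 else 0)
        else if i = k then a m else if Suc i = k then - b m else 0)"
    let ?B = "mat (Suc m) (Suc m) (\<lambda>(i, k). if k = 0 then a i ^ m
        else a i ^ (m - k) * b i ^ (k - 1) * (a m * b i - b m * a i))"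
    \<comment> \<open>Multiplication by \<open>?U\<close> replaces column \<open>k\<close> by \<open>a m\<close> times itself minus \<open>b m\<close> times column \<open>k - 1\<close>,
      which clears the last row.\<close>
    have "?A * ?U = ?B"
    proof (rule eq_matI)
      fix i k assume "i < dim_row ?B" "k < dim_col ?B"
      then have i: "i < Suc m" and k: "k < Suc m" by auto
      have "(?A * ?U) $$ (i, k) = (\<Sum>l<Suc m. a i ^ (m - l) * b i ^ l * ?U $$ (l, k))"
        using i k by (simp add: scalar_prod_def atLeast0LessThan)
      also have "\<dots> = ?B $$ (i, k)"
      proof (cases k)
        case 0
        have "(\<Sum>l<Suc m. a i ^ (m - l) * b i ^ l * ?U $$ (l, k))
          = (\<Sum>l\<in>{0}. a i ^ (m - l) * b i ^ l * ?U $$ (l, k))"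
          using 0 by (intro sum.mono_neutral_right) auto
        then show ?thesis using 0 i by simp
      next
        case (Suc k')
        have "(\<Sum>l<Suc m. a i ^ (m - l) * b i ^ l * ?U $$ (l, k))
          = (\<Sum>l\<in>{k', k}. a i ^ (m - l) * b i ^ l * ?U $$ (l, k))"
          using Suc k by (intro sum.mono_neutral_right) auto
        moreover have "m - k' = Suc (m - k)" using Suc k by simp
        ultimately show ?thesis using Suc k i by (simp add: algebra_simps)
      qed
      finally show "(?A * ?U) $$ (i, k) = ?B $$ (i, k)" .
    qed auto
    then have "Determinant.det ?A * Determinant.det ?U = Determinant.det ?B"
      by (subst det_mult[OF A, symmetric]) auto
    moreover have "Determinant.det ?U = a m ^ m"
    proof -
      have "Determinant.det ?U = prod_list (diag_mat ?U)"
        by (rule det_upper_triangular[where n = "Suc m"]) (auto simp: upper_triangular_def)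
      also have "\<dots> = (\<Prod>i<Suc m. if i = 0 then 1 else a m)"
        unfolding prod_list_diag_prod dim_row_mat atLeast0LessThan
        by (intro prod.cong refl) auto
      also have "\<dots> = a m ^ m"
        by (subst prod.lessThan_Suc_shift) simp
      finally show ?thesis .
    qed
    moreover have "Determinant.det ?B = a m ^ m * ((\<Prod>i<m. a i * b m - a m * b i) * Determinant.det ?V)"
    proof -
      have "Determinant.det ?B = (\<Sum>j<Suc m. ?B $$ (m, j) * cofactor ?B m j)"
        by (rule laplace_expansion_row) auto
      also have "\<dots> = (\<Sum>j\<in>{0}. ?B $$ (m, j) * cofactor ?B m j)"
        by (rule sum.mono_neutral_right) auto
      also have "\<dots> = a m ^ m * ((-1) ^ m * Determinant.det (mat_delete ?B m 0))"
        by (simp add: cofactor_def)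
      also have "mat_delete ?B m 0
          = mat m m (\<lambda>(i, k). (a m * b i - b m * a i) * (a i ^ (m - 1 - k) * b i ^ k))"
        by (rule eq_matI) (auto simp: mat_delete_def mult_ac)
      \<comment> \<open>The cofactor sign of the corner entry is spread over the m row factors and
        turns each of them into \<open>a i * b m - a m * b i\<close>.\<close>
      also have "(-1) ^ m * Determinant.det \<dots> = (\<Prod>i<m. - 1 * (a m * b i - b m * a i)) * Determinant.det ?V"
        by (subst rows, subst prod.distrib) (simp add: mult_ac)
      finally show ?thesis by (simp add: mult_ac)
    qed
    ultimately show ?thesis using False by simp
  qed
  then show ?case using Suc by (simp add: mult_ac)
qed

section \<open>Expansion of the harmonic numbers\<close>

text \<open>\<open>g (1 / m)\<close> is \<open>1 / (m + 1)\<close> minus the increment of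
  \<open>1 / (2 n) - 1 / (12 n^2)\<close> from n = m to n = m + 1. At x = 1/m the two bounds thus
  say that the remainder of the harmonic expansion decreases, and that it increases once
  \<open>1 / n ^ 4\<close> is subtracted. Both hold because the differences vanish at 0 and have
  nonnegative derivatives.\<close>

lemma ln_one_plus_bounds:
  fixes x :: real
  assumes "x \<ge> 0"
  defines "g \<equiv> \<lambda>x::real. x / (2 * (1 + x)) + x / 2 + ((x / (1 + x))\<^sup>2 - x\<^sup>2) / 12"
  shows "g x \<le> ln (1 + x)" and "ln (1 + x) \<le> g x + (x ^ 4 - (x / (1 + x)) ^ 4)"
proof -
  define f where "f y = ln (1 + y) - g y" for y
  have f': "(f has_real_derivative y ^ 4 / (6 * (1 + y) ^ 3)) (at y)" if "y \<ge> 0" for y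
    unfolding f_def g_def
    apply (rule derivative_eq_intros refl | (use that in \<open>simp; fail\<close>))+
    using that apply (simp add: divide_simps)
    apply (simp add: algebra_simps eval_nat_numeral)
    done
  have "f 0 \<le> f x"
    using assms(1) by (rule DERIV_nonneg_imp_nondecreasing) (use f' in fastforce)
  then show "g x \<le> ln (1 + x)" by (simp add: f_def g_def)
  define h where "h y = y ^ 4 - (y / (1 + y)) ^ 4" for y :: real
  have h': "(h has_real_derivative 4 * y ^ 3 - 4 * y ^ 3 / (1 + y) ^ 5) (at y)" if "y \<ge> 0" for y
    unfolding h_def
    apply (rule derivative_eq_intros refl | (use that in \<open>simp; fail\<close>))+
    using that apply (simp add: divide_simps)
    apply (simp add: algebra_simps eval_nat_numeral)
    done
  have "4 * y ^ 3 - 4 * y ^ 3 / (1 + y) ^ 5 - y ^ 4 / (6 * (1 + y) ^ 3) \<ge> 0" if "y \<ge> 0" for y :: real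
  proof -
    have frac: "4 * a - 4 * a / u ^ 5 - b / (6 * u ^ 3) = (24 * a * (u ^ 5 - 1) - b * u\<^sup>2) / (6 * u ^ 5)"
      if "u \<noteq> 0" for a b u :: real
      using that by (simp add: field_simps eval_nat_numeral)
    have "24 * y ^ 3 * ((1 + y) ^ 5 - 1) - y ^ 4 * (1 + y)\<^sup>2
        = y ^ 4 * (119 + 238 * y + 239 * y\<^sup>2 + 120 * y ^ 3 + 24 * y ^ 4)"
      by (simp add: algebra_simps eval_nat_numeral)
    then have "4 * y ^ 3 - 4 * y ^ 3 / (1 + y) ^ 5 - y ^ 4 / (6 * (1 + y) ^ 3)
        = y ^ 4 * (119 + 238 * y + 239 * y\<^sup>2 + 120 * y ^ 3 + 24 * y ^ 4) / (6 * (1 + y) ^ 5)"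
      using that by (subst frac) auto
    then show ?thesis using that by simp
  qed
  then have "h 0 - f 0 \<le> h x - f x"
    using assms(1) by (intro DERIV_nonneg_imp_nondecreasing[of 0 x "\<lambda>y. h y - f y"])
      (use f' h' in \<open>fastforce intro: DERIV_diff\<close>)+
  then show "ln (1 + x) \<le> g x + (x ^ 4 - (x / (1 + x)) ^ 4)"
    by (simp add: f_def g_def h_def)
qed

text \<open>A decreasing sequence with limit 0 is nonnegative, an increasing one is nonpositive. The
  order n^-4 is dictated by the 2-energy, where the remainder is multiplied by n^2 / 4; the
  coefficient 1 is generous, the next term of the expansion being 1 / (120 n^4).\<close>

lemma harm_expansion_bounds:
  fixes n :: nat
  assumes "n > 0"
  defines "r \<equiv> \<lambda>n. harm n - (ln (real n) + euler_mascheroni + 1 / (2 * real n) - 1 / (12 * (real n)\<^sup>2))"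
  shows "0 \<le> r n" and "r n \<le> 1 / real n ^ 4"
proof -
  have r0: "r \<longlonglongrightarrow> 0"
  proof -
    have "(\<lambda>n. (harm n - ln (real n)) - (euler_mascheroni + 1 / (2 * real n) - 1 / (12 * (real n)\<^sup>2)))
        \<longlonglongrightarrow> euler_mascheroni - (euler_mascheroni + 0 - 0 :: real)"
      by (intro tendsto_diff euler_mascheroni_LIMSEQ tendsto_add tendsto_const) real_asymp+
    then show ?thesis by (simp add: r_def algebra_simps)
  qed
  have step: "r (Suc m) \<le> r m" "r m - 1 / real m ^ 4 \<le> r (Suc m) - 1 / real (Suc m) ^ 4" if "m > 0" for m
  proof -
    define x where "x = 1 / real m"
    have m: "real m = 1 / x" and x: "x > 0" using that by (simp_all add: x_def)
    have Suc_m: "real (Suc m) = (1 + x) / x" using x m by (simp add: field_simps)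
    have "ln (real (Suc m)) - ln (real m) = ln (1 + x)"
      using x unfolding Suc_m m by (simp add: ln_div)
    then have "r (Suc m) - r m = 1 / real (Suc m) - ln (1 + x)
        - (1 / (2 * real (Suc m)) - 1 / (2 * real m)) + (1 / (12 * (real (Suc m))\<^sup>2) - 1 / (12 * (real m)\<^sup>2))"
      by (simp add: r_def harm_Suc inverse_eq_divide)
    also have "\<dots> = x / (2 * (1 + x)) + x / 2 + ((x / (1 + x))\<^sup>2 - x\<^sup>2) / 12 - ln (1 + x)"
      unfolding Suc_m m using x by (simp add: divide_simps) (simp add: algebra_simps eval_nat_numeral)
    finally have d: "r (Suc m) - r m = \<dots>" .
    show "r (Suc m) \<le> r m"
      using ln_one_plus_bounds(1)[of x] x d by linarith
    have "1 / real m ^ 4 = x ^ 4" "1 / real (Suc m) ^ 4 = (x / (1 + x)) ^ 4"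
      unfolding Suc_m m by (simp_all add: power_divide)
    then show "r m - 1 / real m ^ 4 \<le> r (Suc m) - 1 / real (Suc m) ^ 4"
      using ln_one_plus_bounds(2)[of x] x d by linarith
  qed
  obtain k where n: "n = Suc k" using assms(1) gr0_implies_Suc by blast
  \<comment> \<open>The step inequalities need m > 0, so monotonicity is stated for the sequence
    shifted by one.\<close>
  have "decseq (\<lambda>k. r (Suc k))"
    by (rule decseq_SucI) (use step in auto)
  then show "0 \<le> r n"
    unfolding n using r0 by (intro decseq_ge[of "\<lambda>k. r (Suc k)"]) (auto intro: LIMSEQ_Suc)
  have "incseq (\<lambda>k. r (Suc k) - 1 / real (Suc k) ^ 4)"
    by (rule incseq_SucI) (use step(2) in blast)
  moreover have "(\<lambda>n. r n - 1 / real n ^ 4) \<longlonglongrightarrow> 0 - 0"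
    by (intro tendsto_diff r0) real_asymp
  ultimately show "r n \<le> 1 / real n ^ 4"
    unfolding n using incseq_le[of "\<lambda>k. r (Suc k) - 1 / real (Suc k) ^ 4" 0 k] LIMSEQ_Suc by fastforce
qed

section \<open>Distributions determined by moments\<close>

text \<open>The Taylor polynomials of the characteristic function at 0 are built from the moments,
  and boundedness by \<open>B\<close> makes their error at t at most twice
  \<open>(\<bar>t\<bar> * B) ^ n / fact n\<close>, which tends to 0. Equal moments therefore give
  equal characteristic functions, and Levy's uniqueness theorem applies.\<close>

lemma bounded_moments_determine_distribution:
  fixes M1 M2 :: "real measure" and B :: real
  assumes M1: "real_distribution M1" and M2: "real_distribution M2"
    and B1: "AE x in M1. \<bar>x\<bar> \<le> B" and B2: "AE x in M2. \<bar>x\<bar> \<le> B"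
    and moments: "\<And>k. (\<integral>x. x ^ k \<partial>M1) = (\<integral>x. x ^ k \<partial>M2)"
  shows "M1 = M2"
proof (rule Levy_uniqueness[OF M1 M2], rule ext)
  fix t
  have approx: "cmod (char M t - (\<Sum>k\<le>n. ((\<i> * t) ^ k / fact k) * (\<integral>x. x ^ k \<partial>M)))
      \<le> 2 * ((\<bar>t\<bar> * B) ^ n / fact n)"
    if "real_distribution M" and B: "AE x in M. \<bar>x\<bar> \<le> B" for M :: "real measure" and n
  proof -
    interpret real_distribution M by fact
    have pow: "AE x in M. \<bar>x\<bar> ^ k \<le> B ^ k" for k
      using B by eventually_elim (simp add: power_mono)
    have int: "integrable M (\<lambda>x. \<bar>x\<bar> ^ k)" for k
      using pow[of k] by (intro integrable_const_bound[where B = "B ^ k"]) auto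
    have int': "integrable M (\<lambda>x. x ^ k)" for k
      using pow[of k] by (intro integrable_const_bound[where B = "B ^ k"]) (auto simp: power_abs)
    have "(\<integral>x. \<bar>x\<bar> ^ n \<partial>M) \<le> B ^ n"
      by (rule integral_le_const[OF int pow])
    then have "2 * \<bar>t\<bar> ^ n / fact n * (\<integral>x. \<bar>x\<bar> ^ n \<partial>M) \<le> 2 * \<bar>t\<bar> ^ n / fact n * B ^ n"
      by (intro mult_left_mono) auto
    with char_approx1[of n t, OF int'] show ?thesis
      by (simp add: power_mult_distrib)
  qed
  have "cmod (char M1 t - char M2 t) \<le> 4 * ((\<bar>t\<bar> * B) ^ n / fact n)" for n
  proof -
    define S where "S = (\<Sum>k\<le>n. ((\<i> * t) ^ k / fact k) * (\<integral>x. x ^ k \<partial>M2))"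
    have "cmod (char M1 t - char M2 t) \<le> cmod (char M1 t - S) + cmod (char M2 t - S)"
      using norm_triangle_ineq4[of "char M1 t - S" "char M2 t - S"] by simp
    with approx[OF M1 B1, of n] approx[OF M2 B2, of n] show ?thesis
      unfolding moments S_def by linarith
  qed
  moreover have "(\<lambda>n. 4 * ((\<bar>t\<bar> * B) ^ n / fact n)) \<longlonglongrightarrow> 4 * 0"
    using summable_LIMSEQ_zero[OF summable_exp_generic[of "\<bar>t\<bar> * B"]]
    by (intro tendsto_intros) (simp add: divide_inverse mult.commute)
  ultimately have "cmod (char M1 t - char M2 t) \<le> 0"
    by (intro LIMSEQ_le_const[of _ "0::real"]) auto
  then show "char M1 t = char M2 t" by simp
qed

section \<open>One-dimensional integrals\<close>

lemma has_bochner_integral_Beta: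
  fixes b :: real
  assumes "b > 0"
  shows "has_bochner_integral lborel (\<lambda>t. indicator {0..1} t * (t ^ k * (1 - t) powr (b - 1)))
    (Beta (real k + 1) b)"
proof -
  let ?g = "\<lambda>t::real. t powr (real k + 1 - 1) * (1 - t) powr (b - 1)"
  have int: "set_integrable lborel {0..1} ?g"
    using integrable_Beta[of "real k + 1" b] assms by simp
  have "(LBINT t:{0..1}. ?g t) = Beta (real k + 1) b"
    using set_borel_integral_eq_integral(2)[OF int] has_integral_Beta_real[of "real k + 1" b] assms
    by (simp add: integral_unique)
  with int have "has_bochner_integral lborel (\<lambda>t. indicator {0..1} t *\<^sub>R ?g t) (Beta (real k + 1) b)"
    by (simp add: has_bochner_integral_iff set_integrable_def set_lebesgue_integral_def)
  \<comment> \<open>The point 0 must be left out: for k = 0, \<open>powr\<close> gives 0 there but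
    \<open>t ^ 0\<close> is 1.\<close>
  moreover have "AE t in lborel. indicator {0..1} t *\<^sub>R ?g t
      = indicator {0..1} t * (t ^ k * (1 - t) powr (b - 1))"
    using AE_lborel_singleton[of 0]
    by eventually_elim (auto simp: indicator_def powr_realpow)
  ultimately show ?thesis
    by (subst has_bochner_integral_cong_AE[symmetric]) (auto simp del: scaleR_conv_of_real)
qed

lemma geometric_sum_real: "(1 - t) * (\<Sum>j<n. t ^ j) = 1 - (t::real) ^ n"
  by (simp add: one_diff_power_eq)

text \<open>The factor \<open>1 - t ^ m\<close> contains \<open>1 - t\<close>, which raises the
  exponent of \<open>1 - t\<close> from \<open>- s / 2\<close> to \<open>1 - s / 2\<close>. This
  exceeds -1 exactly when \<open>s < 4\<close>, and each term of the remaining geometric sum is a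
  Beta integral.\<close>

lemma has_bochner_integral_riesz_sum:
  fixes s :: real
  assumes "s < 4"
  shows "has_bochner_integral lborel
    (\<lambda>t. indicator {0..1} t * ((1 - t ^ m) * (1 - t) powr (- s / 2)))
    (\<Sum>j<m. Beta (real j + 1) (2 - s / 2))"
proof -
  have "has_bochner_integral lborel
     (\<lambda>t. \<Sum>j<m. indicator {0..1} t * (t ^ j * (1 - t) powr (2 - s / 2 - 1)))
    (\<Sum>j<m. Beta (real j + 1) (2 - s / 2))"
    using assms by (intro has_bochner_integral_sum has_bochner_integral_Beta) auto
  moreover have "AE t in lborel. (\<Sum>j<m. indicator {0..1} t * (t ^ j * (1 - t) powr (2 - s / 2 - 1)))
     = indicator {0..1} t * ((1 - t ^ m) * (1 - t) powr (- s / 2))"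
    using AE_lborel_singleton[of "1::real"]
  proof eventually_elim
    case (elim t)
    have "(1 - t) powr (2 - s / 2 - 1) = (1 - t) * (1 - t) powr (- s / 2)" if "t < 1"
      using that powr_add[of "1 - t" 1 "- s / 2"] by simp
    with elim show ?case
      unfolding geometric_sum_real[symmetric, of t m]
      by (auto simp: indicator_def sum_distrib_left sum_distrib_right mult_ac)
  qed
  ultimately show ?thesis
    by (subst has_bochner_integral_cong_AE[symmetric]) auto
qed

text \<open>\<open>Beta (x + 1) y + Beta x (y + 1) = Beta x y\<close> turns each term into
  \<open>Beta (j + 1) c - Beta (j + 2) c\<close>, starting from \<open>Beta 1 c = 1 / c\<close>. For
  \<open>c < 0\<close>, which is the range 2 < s < 4 when c = 1 - s/2, the values of
  \<open>Beta\<close> at \<open>c\<close> are quotients of Gamma values and no longer convergent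
  integrals, so the argument uses the functional equation only.\<close>

lemma sum_Beta_telescope:
  fixes c :: real
  assumes "c > -1" "c \<noteq> 0"
  shows "(\<Sum>j<m. Beta (real j + 1) (c + 1)) = 1 / c - Beta (real m + 1) c"
proof (induction m)
  case 0
  have "c \<notin> \<int>\<^sub>\<le>\<^sub>0" using assms by (auto elim!: nonpos_Ints_cases)
  then have "Beta 1 c = 1 / c"
    using Gamma_plus1[of c] Gamma_eq_zero_iff[of c] by (simp add: Beta_def add.commute)
  then show ?case by simp
next
  case (Suc m)
  have "c \<notin> \<int>\<^sub>\<le>\<^sub>0" using assms by (auto elim!: nonpos_Ints_cases)
  moreover have "real m + 1 \<notin> \<int>\<^sub>\<le>\<^sub>0" by (auto elim!: nonpos_Ints_cases)
  ultimately show ?case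
    using Suc Beta_plus1_plus1[of "real m + 1" c] by (simp add: add_ac)
qed

lemma sum_Beta_one: "(\<Sum>j<m. Beta (real j + 1) 1) = harm m"
proof -
  have "Beta (real j + 1) 1 = inverse (real (Suc j))" for j
  proof -
    have "real j + 1 \<notin> \<int>\<^sub>\<le>\<^sub>0" by (auto elim!: nonpos_Ints_cases)
    then show ?thesis
      using Gamma_plus1[of "real j + 1"] Gamma_eq_zero_iff[of "real j + 1"]
      by (simp add: Beta_def add.commute inverse_eq_divide distrib_right[symmetric] del: distrib_right)
  qed
  then show ?thesis by (simp add: harm_altdef)
qed

lemma has_bochner_integral_log:
  assumes "n > 0"
  shows "has_bochner_integral lborel
    (\<lambda>t. indicator {0..1} t * ((1 - t ^ (n - 1)) * ln (1 - t))) (harm n / n - 1)"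
proof -
  let ?f = "\<lambda>t::real. - ((1 - t ^ (n - 1)) * ln (1 - t))"
  \<comment> \<open>Integration by parts: \<open>t - t ^ n / n - (1 - 1 / n)\<close> is the
    antiderivative of \<open>1 - t ^ (n - 1)\<close> that vanishes at 1. This form of
    \<open>F\<close> displays the factor \<open>(1 - t) * ln (1 - t)\<close>, hence its limit at 1;
    \<open>F_alt\<close> is the form to differentiate. The sign makes the integrand nonnegative, as
    the improper fundamental theorem used below requires.\<close>
  define F where "F t = - (((\<Sum>j<n. t ^ j) / n - 1) * ((1 - t) * ln (1 - t))
      - t + (\<Sum>j<n. t ^ Suc j / real (Suc j)) / n)" for t :: real
  have F_alt: "F t = - ((t - t ^ n / n - (1 - 1 / n)) * ln (1 - t)
      - t + (\<Sum>j<n. t ^ Suc j / real (Suc j)) / n)" for t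
  proof -
    have "((\<Sum>j<n. t ^ j) / n - 1) * ((1 - t) * ln (1 - t))
        = (((1 - t) * (\<Sum>j<n. t ^ j)) / n - (1 - t)) * ln (1 - t)"
      by (simp add: diff_divide_distrib algebra_simps)
    also have "\<dots> = (t - t ^ n / n - (1 - 1 / n)) * ln (1 - t)"
      unfolding geometric_sum_real by (simp add: diff_divide_distrib algebra_simps)
    finally show ?thesis by (simp add: F_def)
  qed
  have deriv: "(F has_real_derivative ?f t) (at t)" if t: "0 < t" "t < 1" for t
  proof -
    have S: "((\<lambda>t. \<Sum>j<n. t ^ Suc j / real (Suc j)) has_real_derivative (\<Sum>j<n. t ^ j)) (at t)"
      by (rule DERIV_sum) (auto intro!: derivative_eq_intros simp del: power_Suc)
    have "(\<Sum>j<n. t ^ j) = (1 - t ^ n) / (1 - t)"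
      using geometric_sum_real[of t n] t by (simp add: field_simps)
    note S' = S[unfolded this]
    have Q: "((\<lambda>t. t - t ^ n / n - (1 - 1 / n)) has_real_derivative 1 - t ^ (n - 1)) (at t)"
      using assms by (auto intro!: derivative_eq_intros)
    have L: "((\<lambda>t. ln (1 - t)) has_real_derivative - (1 / (1 - t))) (at t)"
      using t by (auto intro!: derivative_eq_intros)
    show ?thesis
      unfolding F_alt[abs_def]
      by (rule DERIV_cong[OF DERIV_minus[OF DERIV_add[OF DERIV_diff[OF DERIV_mult[OF Q L]
              DERIV_ident] DERIV_cdivide[OF S']]]])
        (use t assms in \<open>simp add: divide_simps; simp add: algebra_simps\<close>)
  qed
  have lim0: "(F \<longlongrightarrow> 0) (at_right 0)"
  proof -
    have "(F \<longlongrightarrow> - (((\<Sum>j<n. 0 ^ j) / n - 1) * ((1 - 0) * ln (1 - 0))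
        - 0 + (\<Sum>j<n. 0 ^ Suc j / real (Suc j)) / n)) (at_right 0)"
      unfolding F_def[abs_def] by (intro tendsto_intros) (use assms in auto)
    then show ?thesis by simp
  qed
  have lim1: "(F \<longlongrightarrow> 1 - harm n / n) (at_left 1)"
  proof -
    have "((\<lambda>t::real. (1 - t) * ln (1 - t)) \<longlongrightarrow> 0) (at_left 1)" by real_asymp
    then have "(F \<longlongrightarrow> - (((\<Sum>j<n. 1 ^ j) / n - 1) * 0 - 1 + (\<Sum>j<n. 1 ^ Suc j / real (Suc j)) / n)) (at_left 1)"
      unfolding F_def[abs_def] by (intro tendsto_intros) (use assms in auto)
    then show ?thesis by (simp add: harm_altdef inverse_eq_divide)
  qed
  have nonneg: "0 \<le> ?f t" if "0 < t" "t < 1" for t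
    using that mult_nonneg_nonpos[of "1 - t ^ (n - 1)" "ln (1 - t)"] by (simp add: power_le_one)
  have cont: "isCont ?f t" if "0 < t" "t < 1" for t
    using that by (intro continuous_intros) auto
  note FTC = interval_integral_FTC_nonneg[where a = 0 and b = 1 and F = F and f = ?f and A = 0
      and B = "1 - harm n / n"]
  have zero_one: "(0::ereal) = ereal 0" "(1::ereal) = ereal 1" by (simp_all add: zero_ereal_def one_ereal_def)
  have "set_integrable lborel (einterval 0 1) ?f" "(LBINT x=0..1. ?f x) = 1 - harm n / n - 0"
    using FTC cont deriv nonneg lim0 lim1 assms
    by (auto simp: zero_one ereal_tendsto_simps)
  then have "has_bochner_integral lborel (\<lambda>t. - (indicator {0<..<1} t *\<^sub>R ?f t)) (- (1 - harm n / n))"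
    by (intro has_bochner_integral_minus)
      (simp add: has_bochner_integral_iff set_integrable_def set_lebesgue_integral_def
        interval_lebesgue_integral_def zero_one)
  moreover have "AE t in lborel. - (indicator {0<..<1} t *\<^sub>R ?f t)
      = indicator {0..1} t * ((1 - t ^ (n - 1)) * ln (1 - t))"
    using AE_lborel_singleton[of "1::real"] AE_lborel_singleton[of "0::real"]
    by eventually_elim (auto simp: indicator_def)
  ultimately show ?thesis
    by (subst has_bochner_integral_cong_AE[symmetric]) auto
qed

section \<open>Pair integrals of determinantal densities\<close>

lemma measurable_cnj[measurable]: "cnj \<in> borel_measurable borel"
  by (intro borel_measurable_continuous_onI continuous_intros)

lemma (in finite_measure) finite_measure_PiM:
  assumes "finite I"
  shows "finite_measure (Pi\<^sub>M I (\<lambda>_. M))"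
proof -
  interpret product_sigma_finite "\<lambda>_. M" by standard
  show ?thesis
    by standard (use assms in \<open>simp add: space_PiM emeasure_PiM ennreal_prod_eq_top power_eq_top_ennreal\<close>)
qed

context finite_measure
begin

context
  fixes f :: "'a \<Rightarrow> 'a \<Rightarrow> complex" and g :: "'i \<Rightarrow> 'a \<Rightarrow> complex" and I :: "'i set" and i j :: 'i
    and B C :: real
  assumes I: "finite I" "i \<in> I" "j \<in> I" "i \<noteq> j"
    and f: "case_prod f \<in> borel_measurable (M \<Otimes>\<^sub>M M)"
    and f_bound: "\<And>x y. x \<in> space M \<Longrightarrow> y \<in> space M \<Longrightarrow> cmod (f x y) \<le> C"
    and g: "\<And>r. r \<in> I \<Longrightarrow> g r \<in> borel_measurable M"
    and g_bound: "\<And>r x. r \<in> I \<Longrightarrow> x \<in> space M \<Longrightarrow> cmod (g r x) \<le> B"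
begin

lemma integrable_PiM_pair_times_prod:
  "integrable (Pi\<^sub>M I (\<lambda>_. M)) (\<lambda>x. f (x i) (x j) * (\<Prod>r\<in>I. g r (x r)))"
proof -
  interpret P: finite_measure "Pi\<^sub>M I (\<lambda>_. M)" by (rule finite_measure_PiM) fact
  note [measurable] = f g
  show ?thesis
  proof (rule P.integrable_const_bound)
    show "AE x in Pi\<^sub>M I (\<lambda>_. M). cmod (f (x i) (x j) * (\<Prod>r\<in>I. g r (x r))) \<le> C * (\<Prod>r\<in>I. B)"
    proof (rule AE_I2)
      fix x assume x: "x \<in> space (Pi\<^sub>M I (\<lambda>_. M))"
      then have "x r \<in> space M" if "r \<in> I" for r
        using that by (auto simp: space_PiM PiE_def)
      then show "cmod (f (x i) (x j) * (\<Prod>r\<in>I. g r (x r))) \<le> C * (\<Prod>r\<in>I. B)"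
        unfolding norm_mult prod_norm[symmetric] using I f_bound g_bound
        by (intro mult_mono prod_mono conjI norm_ge_zero prod_nonneg)
          (auto intro: order_trans[OF norm_ge_zero])
    qed
    show "(\<lambda>x. f (x i) (x j) * (\<Prod>r\<in>I. g r (x r))) \<in> borel_measurable (Pi\<^sub>M I (\<lambda>_. M))"
      using I by measurable
  qed
qed

text \<open>\<open>f\<close> couples only the coordinates i and j, so \<open>merge\<close> splits
  the integrand into a product over the other coordinates and a function of the pair; boundedness on
  a finite measure settles every integrability condition of Fubini's theorem.\<close>

lemma integral_PiM_pair_times_prod:
  "(\<integral>x. f (x i) (x j) * (\<Prod>r\<in>I. g r (x r)) \<partial>Pi\<^sub>M I (\<lambda>_. M))
    = (\<integral>p. f (fst p) (snd p) * (g i (fst p) * g j (snd p)) \<partial>(M \<Otimes>\<^sub>M M))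
      * (\<Prod>r\<in>I - {i, j}. \<integral>x. g r x \<partial>M)"
proof -
  define J where "J = I - {i, j}"
  have J: "finite J" "J \<inter> {i, j} = {}" and I_eq: "J \<union> {i, j} = I" and I_ins: "I = insert i (insert j J)"
    using I by (auto simp: J_def)
  interpret product_sigma_finite "\<lambda>_. M" by standard
  interpret P2: finite_measure "Pi\<^sub>M {i, j} (\<lambda>_. M)" by (rule finite_measure_PiM) simp
  interpret MM: pair_sigma_finite M M by standard
  interpret MM: finite_measure "M \<Otimes>\<^sub>M M" by (intro finite_measure_pair_measure) unfold_locales
  note f[measurable]
  have [measurable]: "g i \<in> borel_measurable M" "g j \<in> borel_measurable M"
    using I g by auto
  let ?F = "\<lambda>x. f (x i) (x j) * (\<Prod>r\<in>I. g r (x r))"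
  let ?h = "\<lambda>z y. f z y * (g i z * g j y)"
  have h_bound: "cmod (?h z y) \<le> C * (B * B)" if "z \<in> space M" "y \<in> space M" for z y
    unfolding norm_mult using I that f_bound g_bound
    by (intro mult_mono mult_nonneg_nonneg) (blast intro: order_trans[OF norm_ge_zero])+
  have F_int: "integrable (Pi\<^sub>M (J \<union> {i, j}) (\<lambda>_. M)) ?F"
    unfolding I_eq by (rule integrable_PiM_pair_times_prod)
  have h_int: "integrable (Pi\<^sub>M (insert i {j}) (\<lambda>_. M)) (\<lambda>x. ?h (x i) (x j))"
    by (rule P2.integrable_const_bound[where B = "C * (B * B)"], rule AE_I2, rule h_bound)
      (auto simp: space_PiM PiE_def)
  have h_int': "integrable (M \<Otimes>\<^sub>M M) (\<lambda>(z, y). ?h z y)"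
    by (rule MM.integrable_const_bound[where B = "C * (B * B)"], rule AE_I2)
      (use h_bound in \<open>auto simp: space_pair_measure\<close>)
  have merge: "?F (merge J {i, j} (x, y)) = (\<Prod>r\<in>J. g r (x r)) * ?h (y i) (y j)" for x y
  proof -
    have "(\<Prod>r\<in>J. g r (merge J {i, j} (x, y) r)) = (\<Prod>r\<in>J. g r (x r))"
      by (intro prod.cong) (auto simp: merge_def)
    moreover have "merge J {i, j} (x, y) i = y i" "merge J {i, j} (x, y) j = y j"
      using J by (auto simp: merge_def)
    ultimately show ?thesis
      using J I unfolding I_ins by simp
  qed
  have "(\<integral>x. ?F x \<partial>Pi\<^sub>M I (\<lambda>_. M)) = (\<integral>x. ?F x \<partial>Pi\<^sub>M (J \<union> {i, j}) (\<lambda>_. M))"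
    by (simp only: I_eq)
  also have "\<dots> = (\<integral>x. \<integral>y. ?F (merge J {i, j} (x, y)) \<partial>Pi\<^sub>M {i, j} (\<lambda>_. M) \<partial>Pi\<^sub>M J (\<lambda>_. M))"
    using J by (intro product_integral_fold F_int) auto
  also have "\<dots> = (\<integral>x. \<integral>y. (\<Prod>r\<in>J. g r (x r)) * ?h (y i) (y j) \<partial>Pi\<^sub>M {i, j} (\<lambda>_. M) \<partial>Pi\<^sub>M J (\<lambda>_. M))"
    by (simp only: merge)
  also have "(\<integral>x. \<integral>y. (\<Prod>r\<in>J. g r (x r)) * ?h (y i) (y j) \<partial>Pi\<^sub>M {i, j} (\<lambda>_. M) \<partial>Pi\<^sub>M J (\<lambda>_. M))
      = (\<integral>y. ?h (y i) (y j) \<partial>Pi\<^sub>M {i, j} (\<lambda>_. M)) * (\<integral>x. (\<Prod>r\<in>J. g r (x r)) \<partial>Pi\<^sub>M J (\<lambda>_. M))"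
    by (simp only: integral_mult_right_zero integral_mult_left_zero mult.commute)
  also have "(\<integral>x. (\<Prod>r\<in>J. g r (x r)) \<partial>Pi\<^sub>M J (\<lambda>_. M)) = (\<Prod>r\<in>J. \<integral>x. g r x \<partial>M)"
    using g g_bound J
    by (intro product_integral_prod integrable_const_bound[where B = B]) (auto simp: J_def)
  also have "(\<integral>y. ?h (y i) (y j) \<partial>Pi\<^sub>M {i, j} (\<lambda>_. M))
      = (\<integral>x. \<integral>z. ?h ((x(i := z)) i) ((x(i := z)) j) \<partial>M \<partial>Pi\<^sub>M {j} (\<lambda>_. M))"
    using I by (intro product_integral_insert h_int) auto
  also have "\<dots> = (\<integral>x. \<integral>z. ?h z (x j) \<partial>M \<partial>Pi\<^sub>M {j} (\<lambda>_. M))"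
    using I by simp
  also have "\<dots> = (\<integral>y. \<integral>z. ?h z y \<partial>M \<partial>M)"
    by (subst product_integral_singleton[symmetric]) auto
  also have "\<dots> = (\<integral>p. ?h (fst p) (snd p) \<partial>(M \<Otimes>\<^sub>M M))"
    using MM.integral_snd[OF h_int'] by (simp add: case_prod_unfold)
  finally show ?thesis by (simp add: J_def)
qed

end

end

section \<open>Permutations and sums over ordered pairs of indices\<close>

lemma permutes_map_pair:
  assumes "i \<in> S" "j \<in> S" "i' \<in> S" "j' \<in> S" "i \<noteq> j" "i' \<noteq> j'"
  obtains p where "p permutes S" "p i = i'" "p j = j'"
proof
  let ?t = "Transposition.transpose i i'"
  \<comment> \<open>First i is moved to i', then the image of j to j'. The second transposition
    fixes i' because neither \<open>?t j\<close> nor \<open>j'\<close> equals i'.\<close>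
  let ?p = "Transposition.transpose (?t j) j' \<circ> ?t"
  have "?t permutes S" using assms by (intro permutes_swap_id)
  moreover from this have "?t j \<in> S" using assms permutes_in_image by metis
  ultimately show "?p permutes S"
    using assms by (intro permutes_compose permutes_swap_id)
  have "?t j \<noteq> i'" using assms by (metis transpose_apply_first transpose_involutory)
  then show "?p i = i'" "?p j = j'" using assms by simp_all
qed

lemma sum_off_diagonal_permute:
  assumes p: "p permutes S"
  shows "(\<Sum>i\<in>S. \<Sum>j\<in>S - {i}. G (p i) (p j)) = (\<Sum>k\<in>S. \<Sum>l\<in>S - {k}. G k l)"
proof -
  have "(\<Sum>j\<in>S - {i}. G (p i) (p j)) = (\<Sum>l\<in>S - {p i}. G (p i) l)" if "i \<in> S" for i
  proof -
    have "bij_betw p (S - {i}) (S - {p i})"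
      using permutes_imp_bij[OF p] that
      by (metis bij_betw_DiffI bij_betw_singletonI empty_subsetI insert_subset permutes_in_image p)
    then show ?thesis by (rule sum.reindex_bij_betw)
  qed
  then have "(\<Sum>i\<in>S. \<Sum>j\<in>S - {i}. G (p i) (p j)) = (\<Sum>i\<in>S. \<Sum>l\<in>S - {p i}. G (p i) l)"
    by simp
  also have "\<dots> = (\<Sum>k\<in>S. \<Sum>l\<in>S - {k}. G k l)"
    by (rule sum.reindex_bij_betw[OF permutes_imp_bij[OF p]])
  finally show ?thesis .
qed

text \<open>The left-hand sum does not depend on the pair \<open>(i, j)\<close>, so it can be averaged over all pairs.\<close>

lemma sum_permutes_pair_average:
  fixes G :: "'i \<Rightarrow> 'i \<Rightarrow> complex"
  assumes S: "finite S" "i \<in> S" "j \<in> S" "i \<noteq> j"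
  shows "of_nat (card S * (card S - 1)) * (\<Sum>p | p permutes S. G (p i) (p j))
    = fact (card S) * (\<Sum>k\<in>S. \<Sum>l\<in>S - {k}. G k l)"
proof -
  let ?T = "\<lambda>i j. \<Sum>p | p permutes S. G (p i) (p j)"
  have T: "?T i' j' = ?T i j" if "i' \<in> S" "j' \<in> S - {i'}" for i' j'
  proof -
    have hyps: "i' \<in> S" "j' \<in> S" "i' \<noteq> j'" using that by auto
    obtain q where q: "q permutes S" "q i = i'" "q j = j'"
      using permutes_map_pair[of i S j i' j', OF S(2,3) hyps(1,2) S(4) hyps(3)] by blast
    \<comment> \<open>Composing with the inverse of a permutation that takes (i, j) to (i', j')
      reindexes one sum into the other.\<close>
    have "?T i j = (\<Sum>p | p permutes S. G ((p \<circ> inv_into UNIV q) (q i)) ((p \<circ> inv_into UNIV q) (q j)))"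
      using permutes_inverses(2)[OF q(1)] by simp
    also have "\<dots> = ?T i' j'"
      unfolding q by (rule sum_permutations_compose_right[OF permutes_inv[OF q(1)], symmetric])
    finally show ?thesis by simp
  qed
  have "of_nat (card S * (card S - 1)) * ?T i j = (\<Sum>i'\<in>S. \<Sum>j'\<in>S - {i'}. ?T i j)"
    using S by simp
  also have "\<dots> = (\<Sum>i'\<in>S. \<Sum>j'\<in>S - {i'}. ?T i' j')"
    by (rule sum.cong[OF refl], rule sum.cong[OF refl], rule T[symmetric]) auto
  also have "\<dots> = (\<Sum>p | p permutes S. \<Sum>i'\<in>S. \<Sum>j'\<in>S - {i'}. G (p i') (p j'))"
    by (subst sum.swap) (simp add: sum.swap[of _ "{p. p permutes S}"])
  also have "\<dots> = (\<Sum>p | p permutes S. \<Sum>k\<in>S. \<Sum>l\<in>S - {k}. G k l)"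
    by (rule sum.cong[OF refl], rule sum_off_diagonal_permute) simp
  also have "\<dots> = fact (card S) * (\<Sum>k\<in>S. \<Sum>l\<in>S - {k}. G k l)"
    using S by (simp add: card_permutations)
  finally show ?thesis .
qed

text \<open>In the double Leibniz expansion of \<open>D * cnj D\<close>, orthogonality integrates
  out all coordinates except i and j, and what survives is a 2x2 minor of the kernel
  \<open>K\<close>, as for every determinantal point process. The factor \<open>n * (n - 1)\<close>
  counts the ordered pairs over which (i, j) is averaged.\<close>

lemma (in finite_measure) determinantal_pair_integral:
  fixes \<phi> :: "nat \<Rightarrow> 'a \<Rightarrow> complex" and h :: "nat \<Rightarrow> complex" and f :: "'a \<Rightarrow> 'a \<Rightarrow> complex"
  assumes ij: "i < n" "j < n" "i \<noteq> j"
    and f[measurable]: "case_prod f \<in> borel_measurable (M \<Otimes>\<^sub>M M)"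
    and f_bound: "\<And>x y. x \<in> space M \<Longrightarrow> y \<in> space M \<Longrightarrow> cmod (f x y) \<le> C"
    and \<phi>: "\<And>k. k < n \<Longrightarrow> \<phi> k \<in> borel_measurable M"
    and \<phi>_bound: "\<And>k x. k < n \<Longrightarrow> x \<in> space M \<Longrightarrow> cmod (\<phi> k x) \<le> B"
    and orth: "\<And>k l. k < n \<Longrightarrow> l < n \<Longrightarrow> (\<integral>x. \<phi> k x * cnj (\<phi> l x) \<partial>M) = (if k = l then h k else 0)"
    and h: "\<And>k. k < n \<Longrightarrow> h k \<noteq> 0"
  defines "D \<equiv> \<lambda>x. \<Sum>\<sigma> | \<sigma> permutes {..<n}. of_int (sign \<sigma>) * (\<Prod>r<n. \<phi> (\<sigma> r) (x r))"
    and "K \<equiv> \<lambda>x y. \<Sum>k<n. \<phi> k x * cnj (\<phi> k y) / h k"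
  shows "of_nat (n * (n - 1)) * (\<integral>x. f (x i) (x j) * (D x * cnj (D x)) \<partial>Pi\<^sub>M {..<n} (\<lambda>_. M))
    = fact n * (\<Prod>k<n. h k) * (\<integral>p. f (fst p) (snd p) *
        (K (fst p) (fst p) * K (snd p) (snd p) - K (fst p) (snd p) * K (snd p) (fst p)) \<partial>(M \<Otimes>\<^sub>M M))"
proof -
  interpret MM: finite_measure "M \<Otimes>\<^sub>M M" by (intro finite_measure_pair_measure) unfold_locales
  let ?S = "{\<sigma>. \<sigma> permutes {..<n}}"
  let ?\<Pi> = "Pi\<^sub>M {..<n} (\<lambda>_. M)"
  let ?t = "Transposition.transpose i j"
  define g where "g \<sigma> \<tau> r x = \<phi> (\<sigma> r) x * cnj (\<phi> (\<tau> r) x)" for \<sigma> \<tau> :: "nat \<Rightarrow> nat" and r x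
  define Q where "Q k k' l l' = (\<integral>p. f (fst p) (snd p) *
      ((\<phi> k (fst p) * cnj (\<phi> k' (fst p))) * (\<phi> l (snd p) * cnj (\<phi> l' (snd p)))) \<partial>(M \<Otimes>\<^sub>M M))" for k k' l l'
  define H where "H = (\<Prod>k<n. h k)"
  \<comment> \<open>\<open>G k l\<close> is the total contribution of all \<tau> to a fixed \<sigma>
    with \<sigma> i = k and \<sigma> j = l. \<open>H / (h k * h l)\<close> is the product of the
    norms of the other coordinates, and the minus sign is the sign of the transposition.\<close>
  define G where "G k l = H / (h k * h l) * (Q k k l l - Q k l l k)" for k l
  have perm_less: "\<sigma> r < n" if "\<sigma> permutes {..<n}" "r < n" for \<sigma> r
    using permutes_in_image[OF that(1), of r] that(2) by simp
  have g[measurable]: "g \<sigma> \<tau> r \<in> borel_measurable M"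
    and g_bound: "x \<in> space M \<Longrightarrow> cmod (g \<sigma> \<tau> r x) \<le> B * B"
    if "\<sigma> permutes {..<n}" "\<tau> permutes {..<n}" "r < n" for \<sigma> \<tau> r x
  proof -
    note [measurable] = \<phi>[OF perm_less[OF that(1,3)]] \<phi>[OF perm_less[OF that(2,3)]]
    show "g \<sigma> \<tau> r \<in> borel_measurable M"
      unfolding g_def by measurable
    show "cmod (g \<sigma> \<tau> r x) \<le> B * B" if x: "x \<in> space M"
      using \<phi>_bound[OF perm_less[OF \<open>\<sigma> permutes {..<n}\<close> \<open>r < n\<close>] x]
        \<phi>_bound[OF perm_less[OF \<open>\<tau> permutes {..<n}\<close> \<open>r < n\<close>] x]
      by (auto simp: g_def norm_mult intro!: mult_mono order_trans[OF norm_ge_zero])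
  qed
  define W where "W \<sigma> \<tau> = (\<integral>x. f (x i) (x j) * (\<Prod>r<n. g \<sigma> \<tau> r (x r)) \<partial>?\<Pi>)" for \<sigma> \<tau>
  have W_int: "integrable ?\<Pi> (\<lambda>x. f (x i) (x j) * (\<Prod>r<n. g \<sigma> \<tau> r (x r)))"
    if "\<sigma> permutes {..<n}" "\<tau> permutes {..<n}" for \<sigma> \<tau>
    using ij f_bound g[OF that] g_bound[OF that]
    by (intro integrable_PiM_pair_times_prod[where C = C and B = "B * B"]) auto
  have W: "W \<sigma> \<tau> = Q (\<sigma> i) (\<tau> i) (\<sigma> j) (\<tau> j)
      * (if \<forall>r\<in>{..<n} - {i, j}. \<sigma> r = \<tau> r then H / (h (\<sigma> i) * h (\<sigma> j)) else 0)"
    if \<sigma>: "\<sigma> permutes {..<n}" and \<tau>: "\<tau> permutes {..<n}" for \<sigma> \<tau>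
  proof -
    have "W \<sigma> \<tau> = Q (\<sigma> i) (\<tau> i) (\<sigma> j) (\<tau> j) * (\<Prod>r\<in>{..<n} - {i, j}. \<integral>x. g \<sigma> \<tau> r x \<partial>M)"
      unfolding W_def Q_def using ij f_bound g[OF that] g_bound[OF that]
      by (subst integral_PiM_pair_times_prod[where C = C and B = "B * B"]) (auto simp: g_def)
    also have "(\<Prod>r\<in>{..<n} - {i, j}. \<integral>x. g \<sigma> \<tau> r x \<partial>M)
        = (\<Prod>r\<in>{..<n} - {i, j}. if \<sigma> r = \<tau> r then h (\<sigma> r) else 0)"
      using perm_less[OF \<sigma>] perm_less[OF \<tau>] by (intro prod.cong) (auto simp: g_def orth)
    also have "\<dots> = (if \<forall>r\<in>{..<n} - {i, j}. \<sigma> r = \<tau> r then \<Prod>r\<in>{..<n} - {i, j}. h (\<sigma> r) else 0)"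
      by (auto intro!: prod.cong prod_zero)
    also have "(\<Prod>r\<in>{..<n} - {i, j}. h (\<sigma> r)) = H / (h (\<sigma> i) * h (\<sigma> j))"
    proof -
      have "H = (\<Prod>r<n. h (\<sigma> r))"
        unfolding H_def using prod.permute[OF \<sigma>, of h] by (simp add: o_def)
      also have "{..<n} = insert i (insert j ({..<n} - {i, j}))" using ij by auto
      also have "(\<Prod>r\<in>\<dots>. h (\<sigma> r)) = h (\<sigma> i) * h (\<sigma> j) * (\<Prod>r\<in>{..<n} - {i, j}. h (\<sigma> r))"
        using ij by simp
      finally show ?thesis
        using h[OF perm_less[OF \<sigma> ij(1)]] h[OF perm_less[OF \<sigma> ij(2)]] by simp
    qed
    finally show ?thesis .
  qed
  have t: "?t permutes {..<n}" using ij by (intro permutes_swap_id) auto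
  have id: "id permutes {..<n}" by (rule permutes_id)
  \<comment> \<open>By orthogonality only \<open>\<tau> = \<sigma>\<close> and \<open>\<tau> = \<sigma> \<circ> (i j)\<close> contribute.\<close>
  have inner: "(\<Sum>\<tau>\<in>?S. of_int (sign \<sigma>) * of_int (sign \<tau>) * W \<sigma> \<tau>) = G (\<sigma> i) (\<sigma> j)"
    if \<sigma>: "\<sigma> permutes {..<n}" for \<sigma>
  proof -
    have "(\<Sum>\<tau>\<in>?S. of_int (sign \<sigma>) * of_int (sign \<tau>) * W \<sigma> \<tau>)
        = (\<Sum>\<pi>\<in>?S. of_int (sign \<sigma>) * of_int (sign (\<sigma> \<circ> \<pi>)) * W \<sigma> (\<sigma> \<circ> \<pi>))"
      by (rule setum_permutations_compose_left[OF \<sigma>])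
    also have "\<dots> = (\<Sum>\<pi>\<in>?S. of_int (sign \<pi>) * W \<sigma> (\<sigma> \<circ> \<pi>))"
    proof (rule sum.cong[OF refl])
      fix \<pi> assume "\<pi> \<in> ?S"
      then have "sign (\<sigma> \<circ> \<pi>) = sign \<sigma> * sign \<pi>"
        using \<sigma> by (intro sign_compose) (auto intro: permutes_imp_permutation[of "{..<n}"])
      then show "of_int (sign \<sigma>) * of_int (sign (\<sigma> \<circ> \<pi>)) * W \<sigma> (\<sigma> \<circ> \<pi>) = of_int (sign \<pi>) * W \<sigma> (\<sigma> \<circ> \<pi>)"
        by (simp add: mult.assoc[symmetric] flip: of_int_mult)
    qed
    also have "\<dots> = (\<Sum>\<pi>\<in>{id, ?t}. of_int (sign \<pi>) * W \<sigma> (\<sigma> \<circ> \<pi>))"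
    proof (rule sum.mono_neutral_right)
      show "{id, ?t} \<subseteq> ?S" using t id by auto
      show "\<forall>\<pi>\<in>?S - {id, ?t}. of_int (sign \<pi>) * W \<sigma> (\<sigma> \<circ> \<pi>) = 0"
      proof
        fix \<pi> assume "\<pi> \<in> ?S - {id, ?t}"
        then have \<pi>: "\<pi> permutes {..<n}" and "\<not> \<pi> permutes {i, j}"
          by (auto simp: permutes_doubleton_iff)
        then obtain r where "r \<in> {..<n} - {i, j}" "\<pi> r \<noteq> r"
          using permutes_superset[OF \<pi>] by blast
        moreover from this have "\<sigma> r \<noteq> (\<sigma> \<circ> \<pi>) r"
          by (simp add: inj_eq[OF permutes_inj[OF \<sigma>]])
        ultimately show "of_int (sign \<pi>) * W \<sigma> (\<sigma> \<circ> \<pi>) = 0"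
          using W[OF \<sigma> permutes_compose[OF \<pi> \<sigma>]] by auto
      qed
    qed (simp add: finite_permutations)
    also have "\<dots> = W \<sigma> \<sigma> - W \<sigma> (\<sigma> \<circ> ?t)"
    proof -
      have "id \<noteq> ?t" using ij(3) by (metis id_apply transpose_apply_first)
      then show ?thesis using ij(3) by (simp add: sign_swap_id)
    qed
    also have "\<dots> = G (\<sigma> i) (\<sigma> j)"
    proof -
      have "\<forall>r\<in>{..<n} - {i, j}. \<sigma> r = (\<sigma> \<circ> ?t) r" by (auto simp: transpose_def)
      then have "W \<sigma> (\<sigma> \<circ> ?t) = Q (\<sigma> i) (\<sigma> j) (\<sigma> j) (\<sigma> i) * (H / (h (\<sigma> i) * h (\<sigma> j)))"
        using W[OF \<sigma> permutes_compose[OF t \<sigma>]] by (simp del: o_apply) (simp add: transpose_def)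
      then show ?thesis
        using W[OF \<sigma> \<sigma>] by (simp add: G_def algebra_simps)
    qed
    finally show ?thesis .
  qed
  have DD: "D x * cnj (D x) = (\<Sum>\<sigma>\<in>?S. \<Sum>\<tau>\<in>?S. of_int (sign \<sigma>) * of_int (sign \<tau>) * (\<Prod>r<n. g \<sigma> \<tau> r (x r)))" for x
    unfolding D_def cnj_sum sum_product
    by (intro sum.cong refl) (simp add: g_def prod.distrib mult_ac)
  have "(\<integral>x. f (x i) (x j) * (D x * cnj (D x)) \<partial>?\<Pi>)
      = (\<integral>x. (\<Sum>\<sigma>\<in>?S. \<Sum>\<tau>\<in>?S. of_int (sign \<sigma>) * of_int (sign \<tau>)
          * (f (x i) (x j) * (\<Prod>r<n. g \<sigma> \<tau> r (x r)))) \<partial>?\<Pi>)"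
    by (rule Bochner_Integration.integral_cong[OF refl])
      (simp add: DD sum_distrib_left mult_ac)
  also have "\<dots> = (\<Sum>\<sigma>\<in>?S. \<Sum>\<tau>\<in>?S. of_int (sign \<sigma>) * of_int (sign \<tau>) * W \<sigma> \<tau>)"
  proof (subst Bochner_Integration.integral_sum)
    fix \<sigma> assume "\<sigma> \<in> ?S"
    then show "integrable ?\<Pi> (\<lambda>x. \<Sum>\<tau>\<in>?S. of_int (sign \<sigma>) * of_int (sign \<tau>)
        * (f (x i) (x j) * (\<Prod>r<n. g \<sigma> \<tau> r (x r))))"
      by (intro Bochner_Integration.integrable_sum integrable_mult_right W_int) auto
  next
    show "(\<Sum>\<sigma>\<in>?S. \<integral>x. (\<Sum>\<tau>\<in>?S. of_int (sign \<sigma>) * of_int (sign \<tau>)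
          * (f (x i) (x j) * (\<Prod>r<n. g \<sigma> \<tau> r (x r)))) \<partial>?\<Pi>)
        = (\<Sum>\<sigma>\<in>?S. \<Sum>\<tau>\<in>?S. of_int (sign \<sigma>) * of_int (sign \<tau>) * W \<sigma> \<tau>)"
    proof (rule sum.cong[OF refl])
      fix \<sigma> assume "\<sigma> \<in> ?S"
      then have "integrable ?\<Pi> (\<lambda>x. of_int (sign \<sigma>) * of_int (sign \<tau>)
          * (f (x i) (x j) * (\<Prod>r<n. g \<sigma> \<tau> r (x r))))" if "\<tau> \<in> ?S" for \<tau>
        using that by (intro integrable_mult_right W_int) auto
      then show "(\<integral>x. (\<Sum>\<tau>\<in>?S. of_int (sign \<sigma>) * of_int (sign \<tau>)
          * (f (x i) (x j) * (\<Prod>r<n. g \<sigma> \<tau> r (x r)))) \<partial>?\<Pi>)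
        = (\<Sum>\<tau>\<in>?S. of_int (sign \<sigma>) * of_int (sign \<tau>) * W \<sigma> \<tau>)"
        unfolding W_def by (subst Bochner_Integration.integral_sum) (simp_all only: integral_mult_right_zero)
    qed
  qed
  also have "\<dots> = (\<Sum>\<sigma>\<in>?S. G (\<sigma> i) (\<sigma> j))"
    using inner by simp
  finally have "of_nat (n * (n - 1)) * (\<integral>x. f (x i) (x j) * (D x * cnj (D x)) \<partial>?\<Pi>)
      = fact n * (\<Sum>k<n. \<Sum>l\<in>{..<n} - {k}. G k l)"
    using sum_permutes_pair_average[of "{..<n}" i j G] ij by simp
  \<comment> \<open>For k = l the two \<open>Q\<close> terms cancel. The restriction to distinct
    indices can therefore be dropped, after which the sums factor into kernels.\<close>
  also have "(\<Sum>k<n. \<Sum>l\<in>{..<n} - {k}. G k l) = (\<Sum>k<n. \<Sum>l<n. G k l)"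
    by (intro sum.cong sum.mono_neutral_left) (auto simp: G_def)
  also have "\<dots> = H * (\<integral>p. f (fst p) (snd p) *
        (K (fst p) (fst p) * K (snd p) (snd p) - K (fst p) (snd p) * K (snd p) (fst p)) \<partial>(M \<Otimes>\<^sub>M M))"
  proof -
    let ?q = "\<lambda>k k' l l' p. f (fst p) (snd p) *
        ((\<phi> k (fst p) * cnj (\<phi> k' (fst p))) * (\<phi> l (snd p) * cnj (\<phi> l' (snd p))))"
    have q_int: "integrable (M \<Otimes>\<^sub>M M) (?q k k' l l')" if "k < n" "k' < n" "l < n" "l' < n" for k k' l l'
    proof -
      note [measurable] = \<phi>[OF that(1)] \<phi>[OF that(2)] \<phi>[OF that(3)] \<phi>[OF that(4)]
      show ?thesis
      proof (rule MM.integrable_const_bound[where B = "C * ((B * B) * (B * B))"], rule AE_I2)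
        fix p assume "p \<in> space (M \<Otimes>\<^sub>M M)"
        then have "fst p \<in> space M" "snd p \<in> space M" by (auto simp: space_pair_measure)
        with that show "cmod (?q k k' l l' p) \<le> C * ((B * B) * (B * B))"
          unfolding norm_mult complex_mod_cnj using f_bound \<phi>_bound
          by (intro mult_mono mult_nonneg_nonneg norm_ge_zero)
            (blast intro: order_trans[OF norm_ge_zero])+
      qed measurable
    qed
    have diag: "K z z * K y y = (\<Sum>k<n. \<Sum>l<n. (\<phi> k z * cnj (\<phi> k z)) * (\<phi> l y * cnj (\<phi> l y)) / (h k * h l))" for z y
      unfolding K_def sum_product by simp
    have cross: "K z y * K y z = (\<Sum>k<n. \<Sum>l<n. (\<phi> k z * cnj (\<phi> l z)) * (\<phi> l y * cnj (\<phi> k y)) / (h k * h l))" for z y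
      unfolding K_def sum_product by (intro sum.cong refl) (simp add: mult_ac)
    have "f (fst p) (snd p) * (K (fst p) (fst p) * K (snd p) (snd p) - K (fst p) (snd p) * K (snd p) (fst p))
        = (\<Sum>k<n. \<Sum>l<n. (?q k k l l p - ?q k l l k p) / (h k * h l))" for p
      unfolding diag cross
      by (simp add: sum_distrib_left right_diff_distrib diff_divide_distrib sum_subtractf)
    moreover have "has_bochner_integral (M \<Otimes>\<^sub>M M)
        (\<lambda>p. \<Sum>k<n. \<Sum>l<n. (?q k k l l p - ?q k l l k p) / (h k * h l))
        (\<Sum>k<n. \<Sum>l<n. (Q k k l l - Q k l l k) / (h k * h l))"
      unfolding Q_def
      by (intro has_bochner_integral_sum has_bochner_integral_divide_zero has_bochner_integral_diff
          has_bochner_integral_integrable q_int) auto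
    ultimately have "(\<integral>p. f (fst p) (snd p) *
        (K (fst p) (fst p) * K (snd p) (snd p) - K (fst p) (snd p) * K (snd p) (fst p)) \<partial>(M \<Otimes>\<^sub>M M))
      = (\<Sum>k<n. \<Sum>l<n. (Q k k l l - Q k l l k) / (h k * h l))"
      by (simp only: has_bochner_integral_integral_eq)
    then show ?thesis
      by (simp add: G_def sum_distrib_left)
  qed
  finally show ?thesis by (simp add: H_def)
qed

section \<open>Spinors and orthogonal monomials on the sphere\<close>

text \<open>\<open>(spinor1 p, spinor2 p)\<close> is a unit vector in \<open>\<complex>\<^sup>2\<close> representing \<open>p\<close> under the Hopf map; at the
  south pole the phase of the second component is arbitrary.\<close>

definition spinor1 :: "real ^ 3 \<Rightarrow> complex" where
  "spinor1 p = complex_of_real (sqrt ((1 + p $ 3) / 2))"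

definition spinor2 :: "real ^ 3 \<Rightarrow> complex" where
  "spinor2 p = (if p $ 3 = -1 then 1 else Complex (p $ 1) (p $ 2) / (2 * spinor1 p))"

text \<open>The Hermitian inner product of the two spinors; \<open>spinor1\<close> is real, so it
  carries no \<open>cnj\<close>.\<close>

definition overlap :: "real ^ 3 \<Rightarrow> real ^ 3 \<Rightarrow> complex" where
  "overlap p q = spinor1 p * spinor1 q + spinor2 p * cnj (spinor2 q)"

lemma inner_real3: "p \<bullet> q = p $ 1 * q $ 1 + p $ 2 * q $ 2 + p $ 3 * q $ 3" for p q :: "real ^ 3"
  by (simp add: inner_vec_def sum_3)

lemma S2_coords:
  assumes "p \<in> S2"
  shows "(p $ 1)\<^sup>2 + (p $ 2)\<^sup>2 + (p $ 3)\<^sup>2 = 1" "\<bar>p $ 3\<bar> \<le> 1"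
proof -
  have "p \<bullet> p = 1" using assms by (simp add: dot_square_norm)
  then show "(p $ 1)\<^sup>2 + (p $ 2)\<^sup>2 + (p $ 3)\<^sup>2 = 1" by (simp add: inner_real3 power2_eq_square)
  then have "(p $ 3)\<^sup>2 \<le> 1" by (smt (verit) zero_le_power2)
  then show "\<bar>p $ 3\<bar> \<le> 1" by (simp add: abs_square_le_1)
qed

lemma cnj_spinor1 [simp]: "cnj (spinor1 p) = spinor1 p"
  by (simp add: spinor1_def)

text \<open>These products recover the coordinates of p from its spinor: they are the Hopf map. The
  chord and overlap formulas use spinors only through them, so the arbitrary phase at the south pole
  does no harm, \<open>spinor1 p\<close> being 0 there.\<close>

lemma
  assumes "p \<in> S2"
  shows spinor1_square: "spinor1 p * spinor1 p = complex_of_real ((1 + p $ 3) / 2)"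
    and spinor2_square: "spinor2 p * cnj (spinor2 p) = complex_of_real ((1 - p $ 3) / 2)"
    and spinor1_spinor2: "2 * (spinor1 p * spinor2 p) = Complex (p $ 1) (p $ 2)"
proof -
  have ge: "0 \<le> 1 + p $ 3" using S2_coords(2)[OF assms] by linarith
  show s1: "spinor1 p * spinor1 p = complex_of_real ((1 + p $ 3) / 2)"
    using ge by (simp add: spinor1_def flip: of_real_mult)
  show "spinor2 p * cnj (spinor2 p) = complex_of_real ((1 - p $ 3) / 2)"
  proof (cases "p $ 3 = -1")
    case False
    have c: "Complex (p $ 1) (p $ 2) * cnj (Complex (p $ 1) (p $ 2)) = complex_of_real (1 - (p $ 3)\<^sup>2)"
      using S2_coords(1)[OF assms] by (simp add: complex_mult_cnj flip: of_real_power of_real_add of_real_diff)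
    have "spinor2 p * cnj (spinor2 p)
        = Complex (p $ 1) (p $ 2) * cnj (Complex (p $ 1) (p $ 2)) / (4 * (spinor1 p * spinor1 p))"
      using False by (simp add: spinor2_def)
    also have "\<dots> = complex_of_real ((1 - (p $ 3)\<^sup>2) / (4 * ((1 + p $ 3) / 2)))"
      unfolding c s1 by (simp only: of_real_divide of_real_mult of_real_numeral)
    also have "(1 - (p $ 3)\<^sup>2) / (4 * ((1 + p $ 3) / 2)) = (1 - p $ 3) / 2"
      using False by (simp add: divide_simps) (simp add: algebra_simps power2_eq_square)
    finally show ?thesis .
  qed (simp add: spinor2_def)
  show "2 * (spinor1 p * spinor2 p) = Complex (p $ 1) (p $ 2)"
  proof (cases "p $ 3 = -1")
    case True
    then have "(p $ 1)\<^sup>2 + (p $ 2)\<^sup>2 = 0" using S2_coords(1)[OF assms] by simp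
    then show ?thesis using True by (simp add: spinor1_def sum_power2_eq_zero_iff zero_complex.code)
  next
    case False
    then have "spinor1 p \<noteq> 0" using ge by (simp add: spinor1_def)
    then show ?thesis using False by (simp add: spinor2_def)
  qed
qed

text \<open>This cross term occurs in the squared moduli of both the inner product and the
  determinant of two spinors, with opposite signs. It is twice a real part, computed from
  \<open>spinor1_spinor2\<close> at p and q.\<close>

lemma spinor_cross_terms:
  assumes "p \<in> S2" "q \<in> S2"
  shows "spinor1 p * spinor1 q * (spinor2 p * cnj (spinor2 q) + cnj (spinor2 p) * spinor2 q)
    = complex_of_real ((p $ 1 * q $ 1 + p $ 2 * q $ 2) / 2)"
proof -
  have "4 * (spinor1 p * spinor1 q * (spinor2 p * cnj (spinor2 q) + cnj (spinor2 p) * spinor2 q))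
      = (2 * (spinor1 p * spinor2 p)) * cnj (2 * (spinor1 q * spinor2 q))
        + cnj (2 * (spinor1 p * spinor2 p)) * (2 * (spinor1 q * spinor2 q))"
    by (simp add: algebra_simps)
  also have "\<dots> = 4 * complex_of_real ((p $ 1 * q $ 1 + p $ 2 * q $ 2) / 2)"
    unfolding spinor1_spinor2[OF assms(1)] spinor1_spinor2[OF assms(2)]
    by (simp add: complex_eq_iff)
  finally show ?thesis by (rule mult_left_cancel[THEN iffD1, rotated]) simp
qed

lemma norm_diff_S2:
  assumes "p \<in> S2" "q \<in> S2"
  shows "(norm (p - q))\<^sup>2 = 2 - 2 * (p \<bullet> q)"
  using assms dot_norm_neg[of p q] by simp

lemma overlap_mult_cnj:
  assumes "p \<in> S2" "q \<in> S2"
  shows "overlap p q * cnj (overlap p q) = complex_of_real (1 - (norm (p - q))\<^sup>2 / 4)"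
proof -
  have "overlap p q * cnj (overlap p q)
      = (spinor1 p * spinor1 p) * (spinor1 q * spinor1 q)
        + (spinor2 p * cnj (spinor2 p)) * (spinor2 q * cnj (spinor2 q))
        + spinor1 p * spinor1 q * (spinor2 p * cnj (spinor2 q) + cnj (spinor2 p) * spinor2 q)"
    by (simp add: overlap_def algebra_simps)
  also have "\<dots> = complex_of_real (1 - (norm (p - q))\<^sup>2 / 4)"
    unfolding spinor_cross_terms[OF assms] spinor1_square[OF assms(1)] spinor1_square[OF assms(2)]
      spinor2_square[OF assms(1)] spinor2_square[OF assms(2)] norm_diff_S2[OF assms] inner_real3
      of_real_mult[symmetric] of_real_add[symmetric] of_real_eq_iff
    by (simp add: field_simps)
  finally show ?thesis .
qed

text \<open>Together with \<open>overlap_mult_cnj\<close> this is Lagrange's identity for two unit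
  vectors of the complex plane: the squared moduli of their inner product and of their determinant
  add up to 1.\<close>

lemma chord_spinor:
  assumes "p \<in> S2" "q \<in> S2"
  defines "u \<equiv> spinor1 p * spinor2 q - spinor1 q * spinor2 p"
  shows "complex_of_real ((norm (p - q))\<^sup>2) = 4 * (u * cnj u)"
proof -
  have "u * cnj u
      = (spinor1 p * spinor1 p) * (spinor2 q * cnj (spinor2 q))
        + (spinor1 q * spinor1 q) * (spinor2 p * cnj (spinor2 p))
        - spinor1 p * spinor1 q * (spinor2 p * cnj (spinor2 q) + cnj (spinor2 p) * spinor2 q)"
    by (simp add: u_def algebra_simps)
  also have "\<dots> = complex_of_real ((norm (p - q))\<^sup>2 / 4)"
    unfolding spinor_cross_terms[OF assms(1,2)] spinor1_square[OF assms(1)] spinor1_square[OF assms(2)]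
      spinor2_square[OF assms(1)] spinor2_square[OF assms(2)] norm_diff_S2[OF assms(1,2)] inner_real3
      of_real_mult[symmetric] of_real_add[symmetric] of_real_diff[symmetric] of_real_eq_iff
    by (simp add: field_simps)
  finally show ?thesis by (simp only:) simp
qed

lemma norm_spinor_le:
  assumes "p \<in> S2"
  shows "cmod (spinor1 p) \<le> 1" "cmod (spinor2 p) \<le> 1"
proof -
  have le: "cmod z \<le> 1" if "z * cnj z = complex_of_real r" "r \<le> 1" for z r
  proof -
    have "complex_of_real ((cmod z)\<^sup>2) = complex_of_real r"
      using that(1) complex_norm_square[of z] by simp
    then have "(cmod z)\<^sup>2 \<le> 1" using that(2) unfolding of_real_eq_iff by simp
    then show ?thesis by (simp add: power_le_one_iff)
  qed
  show "cmod (spinor1 p) \<le> 1"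
    using le[of "spinor1 p" "(1 + p $ 3) / 2"] spinor1_square[OF assms] S2_coords(2)[OF assms] by simp
  show "cmod (spinor2 p) \<le> 1"
    using le[of "spinor2 p" "(1 - p $ 3) / 2"] spinor2_square[OF assms] S2_coords(2)[OF assms] by simp
qed

section \<open>Measurability on the sphere and integrals in colatitude and longitude\<close>

lemma space_sphere_area [simp]: "space sphere_area = S2"
  by (simp add: sphere_area_def sphere_borel_def space_restrict_space)

lemma sets_sphere_area [measurable_cong, simp]: "sets sphere_area = sets sphere_borel"
  by (simp add: sphere_area_def)

lemma space_sphere_borel [simp]: "space sphere_borel = S2"
  by (simp add: sphere_borel_def space_restrict_space)

interpretation sphere_area: finite_measure sphere_area
  by (rule finite_measureI) (simp add: emeasure_sphere_area_space)

lemma measurable_sphere_borel_ident [measurable]: "(\<lambda>p. p) \<in> sphere_borel \<rightarrow>\<^sub>M borel"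
  unfolding sphere_borel_def by (rule measurable_restrict_space1) simp

lemma measurable_sphere_borel_nth [measurable]: "(\<lambda>p. p $ i) \<in> borel_measurable sphere_borel"
  by (rule measurable_compose[OF measurable_sphere_borel_ident])
    (intro borel_measurable_continuous_onI continuous_intros)

lemma measurable_spinor1 [measurable]: "spinor1 \<in> borel_measurable sphere_borel"
  unfolding spinor1_def[abs_def] by measurable

lemma measurable_spinor2 [measurable]: "spinor2 \<in> borel_measurable sphere_borel"
  unfolding spinor2_def[abs_def] Complex_eq by measurable

lemma spinor_sph_coords:
  assumes "0 < \<theta>" "\<theta> < pi"
  shows "spinor1 (sph_coords (\<theta>, \<phi>)) = complex_of_real (cos (\<theta> / 2))"
    and "spinor2 (sph_coords (\<theta>, \<phi>)) = complex_of_real (sin (\<theta> / 2)) * cis \<phi>"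
proof -
  have c: "cos (\<theta> / 2) > 0" using assms by (intro cos_gt_zero_pi) auto
  have cos: "cos \<theta> = 2 * (cos (\<theta> / 2))\<^sup>2 - 1" and sin: "sin \<theta> = 2 * sin (\<theta> / 2) * cos (\<theta> / 2)"
    using cos_double_cos[of "\<theta> / 2"] sin_double[of "\<theta> / 2"] by simp_all
  show s1: "spinor1 (sph_coords (\<theta>, \<phi>)) = complex_of_real (cos (\<theta> / 2))"
    using c by (simp add: spinor1_def sph_coords_def cos)
  have "cos \<theta> \<noteq> -1" using c by (simp add: cos)
  then have "spinor2 (sph_coords (\<theta>, \<phi>)) = Complex (sin \<theta> * cos \<phi>) (sin \<theta> * sin \<phi>) / (2 * complex_of_real (cos (\<theta> / 2)))"
    unfolding spinor2_def s1 by (simp add: sph_coords_def)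
  also have "\<dots> = complex_of_real (sin (\<theta> / 2)) * cis \<phi>"
    using c by (simp add: sin complex_eq_iff)
  finally show "spinor2 (sph_coords (\<theta>, \<phi>)) = complex_of_real (sin (\<theta> / 2)) * cis \<phi>" .
qed

lemma LBINT_cis_period:
  fixes k l :: nat
  shows "(\<integral>t. indicator {0..<2 * pi} t *\<^sub>R (cis t ^ k * cnj (cis t ^ l)) \<partial>lborel)
    = (if k = l then of_real (2 * pi) else 0)"
proof (cases "k = l")
  case True
  have "cis t ^ l * cnj (cis t ^ l) = 1" for t
    by (simp add: complex_mult_cnj Complex.DeMoivre flip: power_add)
  then show ?thesis using True by (simp add: scaleR_conv_of_real)
next
  case False
  define m where "m = real k - real l"
  have m: "m \<noteq> 0" using False by (simp add: m_def)
  have eq: "cis t ^ k * cnj (cis t ^ l) = cis (m * t)" for t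
    by (simp add: m_def Complex.DeMoivre cis_cnj cis_mult algebra_simps)
  have "has_bochner_integral lborel (\<lambda>t. indicator {0..2 * pi} t *\<^sub>R cis (m * t))
      (cis (m * (2 * pi)) / (\<i> * m) - cis (m * 0) / (\<i> * m))"
  proof (rule has_bochner_integral_FTC_Icc)
    fix t
    have "((\<lambda>z. exp (\<i> * m * z) / (\<i> * m)) has_field_derivative exp (\<i> * m * of_real t))
        (at (of_real t))"
      using m by (auto intro!: derivative_eq_intros)
    from has_vector_derivative_real_field[OF this]
    show "((\<lambda>t. cis (m * t) / (\<i> * m)) has_vector_derivative cis (m * t)) (at t within {0..2 * pi})"
      by (simp add: cis_conv_exp mult.assoc)
  qed (auto intro!: continuous_intros)
  moreover have "cis (m * (2 * pi)) = 1"
    using cis_multiple_2pi[of m] by (simp add: m_def mult.commute)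
  ultimately have "has_bochner_integral lborel (\<lambda>t. indicator {0..2 * pi} t *\<^sub>R cis (m * t)) 0"
    by simp
  then have "(\<integral>t. indicator {0..2 * pi} t *\<^sub>R cis (m * t) \<partial>lborel) = 0"
    by (rule has_bochner_integral_integral_eq)
  moreover have [measurable]: "(\<lambda>t. cis (m * t)) \<in> borel_measurable borel"
    by (intro borel_measurable_continuous_onI continuous_intros)
  have "(\<integral>t. indicator {0..2 * pi} t *\<^sub>R cis (m * t) \<partial>lborel)
      = (\<integral>t. indicator {0..<2 * pi} t *\<^sub>R cis (m * t) \<partial>lborel)"
    using AE_lborel_singleton[of "2 * pi"]
    by (intro integral_cong_AE) (auto elim!: eventually_mono simp: indicator_def)
  ultimately show ?thesis using False unfolding eq by simp
qed

text \<open>The substitution u = (1 - cos t) / 2, which is the square of sin(t/2), has du = sin t /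
  2 dt and turns the integral into twice \<open>Beta (k + 1) (N - k + 1)\<close>.\<close>

lemma LBINT_sin_half_powers:
  assumes "k \<le> N"
  shows "(LBINT t. indicator {0<..<pi} t * sin t * (cos (t / 2) ^ (2 * (N - k)) * sin (t / 2) ^ (2 * k)))
    = 2 / (real (N + 1) * real (N choose k))"
proof -
  let ?f = "\<lambda>u::real. u ^ k * (1 - u) ^ (N - k)"
  have beta: "Beta (real k + 1) (real (N - k) + 1) = 1 / (real (N + 1) * real (N choose k))"
    using assms Gamma_fact[of k, where 'a = real] Gamma_fact[of "N - k", where 'a = real]
      Gamma_fact[of "N + 1", where 'a = real]
    by (simp add: Beta_def binomial_fact[of k N] of_nat_diff field_simps)
  have "has_bochner_integral lborel (\<lambda>t. indicator {0..1} t * ?f t) (Beta (real k + 1) (real (N - k) + 1))"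
  proof -
    have "AE t in lborel. indicator {0..1} t * (t ^ k * (1 - t) powr (real (N - k) + 1 - 1))
        = indicator {0..1} t * ?f t"
      using AE_lborel_singleton[of "1::real"]
      by eventually_elim (auto simp: indicator_def powr_realpow)
    then show ?thesis
      using has_bochner_integral_Beta[of "real (N - k) + 1" k]
      by (subst has_bochner_integral_cong_AE[symmetric]) auto
  qed
  then have int: "set_integrable lborel {0..1} ?f"
    and val: "(LBINT t. ?f t * indicator {0..1} t) = Beta (real k + 1) (real (N - k) + 1)"
    by (auto simp: has_bochner_integral_iff set_integrable_def mult.commute)
  have sq: "(sin (t / 2))\<^sup>2 = (1 - cos t) / 2" "(cos (t / 2))\<^sup>2 = 1 - (1 - cos t) / 2" for t :: real
    using cos_double_sin[of "t / 2"] cos_double_cos[of "t / 2"] by simp_all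
  have "(LBINT t. indicator {0<..<pi} t * sin t * (cos (t / 2) ^ (2 * (N - k)) * sin (t / 2) ^ (2 * k)))
      = (LBINT t. 2 * (?f ((1 - cos t) / 2) * (sin t / 2) * indicator {0..pi} t))"
    by (intro Bochner_Integration.integral_cong) (auto simp: indicator_def power_mult sq)
  also have "\<dots> = 2 * (LBINT t. ?f ((1 - cos t) / 2) * (sin t / 2) * indicator {0..pi} t)"
    by simp
  also have "(LBINT t. ?f ((1 - cos t) / 2) * (sin t / 2) * indicator {0..pi} t)
      = (LBINT t. ?f t * indicator {(1 - cos 0) / 2..(1 - cos pi) / 2} t)"
    using int
    by (intro integral_substitution(2)[symmetric])
      (auto intro!: derivative_eq_intros continuous_intros sin_ge_zero)
  also have "\<dots> = Beta (real k + 1) (real (N - k) + 1)"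
    using val by simp
  finally show ?thesis by (simp add: beta)
qed

section \<open>Orthogonal monomials and their reproducing kernel\<close>

definition spin_monomial :: "nat \<Rightarrow> nat \<Rightarrow> real ^ 3 \<Rightarrow> complex" where
  "spin_monomial N k p = spinor1 p ^ (N - k) * spinor2 p ^ k"

lemma measurable_spin_monomial [measurable]: "spin_monomial N k \<in> borel_measurable sphere_borel"
  unfolding spin_monomial_def[abs_def] by measurable

lemma norm_spin_monomial_le: "p \<in> S2 \<Longrightarrow> cmod (spin_monomial N k p) \<le> 1"
  by (auto simp: spin_monomial_def norm_mult norm_power norm_spinor_le intro!: mult_le_one power_le_one)

text \<open>In colatitude and longitude the integrand separates: the longitude factor
  \<open>cis t ^ k * cnj (cis t ^ l)\<close> integrates to the Kronecker delta, and for k = l the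
  colatitude factor is the Beta integral of \<open>LBINT_sin_half_powers\<close>.\<close>

lemma spin_monomial_orthogonal:
  assumes k: "k \<le> N" and l: "l \<le> N"
  shows "(\<integral>p. spin_monomial N k p * cnj (spin_monomial N l p) \<partial>sphere_area)
    = (if k = l then of_real (4 * pi / (real (N + 1) * real (N choose k))) else 0)"
proof -
  let ?g = "\<lambda>p. spin_monomial N k p * cnj (spin_monomial N l p)"
  let ?d = "\<lambda>x. indicator ({0<..<pi} \<times> {0..<2 * pi}) x * sin (fst x) :: real"
  let ?F = "\<lambda>t::real. complex_of_real (indicator {0<..<pi} t * sin t
      * (cos (t / 2) ^ (2 * N - k - l) * sin (t / 2) ^ (k + l)))"
  let ?G = "\<lambda>t::real. indicator {0..<2 * pi} t *\<^sub>R (cis t ^ k * cnj (cis t ^ l))"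
  have d: "sphere_area = distr (density lborel (\<lambda>x. ennreal (?d x))) sphere_borel sph_coords"
    unfolding sphere_area_def by (simp add: case_prod_unfold)
  have d_meas [measurable]: "?d \<in> borel_measurable borel"
    unfolding borel_prod[symmetric] by measurable
  have d_nonneg: "0 \<le> ?d x" for x
    by (auto simp: indicator_def sin_ge_zero)
  note [measurable] = measurable_sph_coords[simplified]
  have g_meas: "?g \<in> borel_measurable sphere_borel" by measurable
  have g_comp: "(\<lambda>x. ?g (sph_coords x)) \<in> borel_measurable lborel" by measurable
  have int: "integrable sphere_area ?g"
  proof (rule sphere_area.integrable_const_bound[where B = 1])
    show "AE p in sphere_area. cmod (?g p) \<le> 1"
      by (rule AE_I2) (auto simp: norm_mult norm_spin_monomial_le intro!: mult_le_one)
  qed measurable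
  have FG: "?d (t, u) *\<^sub>R ?g (sph_coords (t, u)) = ?F t * ?G u" for t u
  proof (cases "0 < t \<and> t < pi")
    case True
    have *: "2 * N - k - l = (N - k) + (N - l)" using k l by simp
    show ?thesis
      using True unfolding spin_monomial_def *
      by (simp add: spinor_sph_coords power_add power_mult_distrib scaleR_conv_of_real indicator_times)
  qed (auto simp: indicator_def)
  have int_FG: "integrable (lborel \<Otimes>\<^sub>M lborel) (\<lambda>(t, u). ?F t * ?G u)"
  proof -
    have "integrable (density lborel (\<lambda>x. ennreal (?d x))) (\<lambda>x. ?g (sph_coords x))"
      using int unfolding d by (subst (asm) integrable_distr_eq) (use g_meas in auto)
    then have "integrable lborel (\<lambda>x. ?d x *\<^sub>R ?g (sph_coords x))"
      using g_comp d_nonneg by (subst (asm) integrable_density) auto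
    moreover have "(\<lambda>x. ?d x *\<^sub>R ?g (sph_coords x)) = (\<lambda>(t, u). ?F t * ?G u)"
      using FG by (auto simp only: fun_eq_iff split_paired_all prod.case)
    ultimately show ?thesis
      by (simp only: lborel_prod)
  qed
  have "(\<integral>p. ?g p \<partial>sphere_area) = (\<integral>x. ?g (sph_coords x) \<partial>density lborel (\<lambda>x. ennreal (?d x)))"
    unfolding d by (intro integral_distr g_meas) simp
  also have "\<dots> = (\<integral>x. ?d x *\<^sub>R ?g (sph_coords x) \<partial>lborel)"
    using g_comp d_nonneg by (intro integral_density) auto
  also have "\<dots> = (\<integral>x. (case x of (t, u) \<Rightarrow> ?F t * ?G u) \<partial>(lborel \<Otimes>\<^sub>M lborel))"
    unfolding lborel_prod using FG
    by (intro Bochner_Integration.integral_cong refl) (simp only: split_paired_all prod.case)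
  also have "\<dots> = (\<integral>t. \<integral>u. ?F t * ?G u \<partial>lborel \<partial>lborel)"
    using lborel_pair.integral_fst'[OF int_FG] by simp
  also have "\<dots> = (\<integral>t. ?F t \<partial>lborel) * (\<integral>u. ?G u \<partial>lborel)"
    by (simp only: integral_mult_right_zero integral_mult_left_zero)
  also have "\<dots> = (if k = l then of_real (4 * pi / (real (N + 1) * real (N choose k))) else 0)"
  proof (cases "k = l")
    case True
    have *: "2 * N - k - l = 2 * (N - k)" "k + l = 2 * k" using k True by auto
    have "(\<integral>t. ?F t \<partial>lborel) = of_real (2 / (real (N + 1) * real (N choose k)))"
      unfolding integral_complex_of_real * LBINT_sin_half_powers[OF k] ..
    then show ?thesis
      unfolding LBINT_cis_period using True by simp
  next
    case False
    then show ?thesis unfolding LBINT_cis_period by simp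
  qed
  finally show ?thesis .
qed

lemma overlap_power:
  "overlap p q ^ N = (\<Sum>k\<le>N. of_nat (N choose k) * spin_monomial N k p * cnj (spin_monomial N k q))"
  unfolding overlap_def add.commute[of "spinor1 p * spinor1 q"] binomial_ring spin_monomial_def
  by (intro sum.cong refl) (simp add: power_mult_distrib mult_ac)

text \<open>The reciprocals of the squared norms are proportional to the binomial coefficients, so
  the kernel collapses by the binomial theorem to a single power of the overlap.\<close>

lemma spin_kernel:
  "(\<Sum>k\<le>N. spin_monomial N k p * cnj (spin_monomial N k q) / of_real (4 * pi / (real (N + 1) * real (N choose k))))
    = of_real (real (N + 1) / (4 * pi)) * overlap p q ^ N"
  unfolding overlap_power sum_distrib_left by (intro sum.cong refl) (simp add: field_simps)

lemma cnj_overlap: "cnj (overlap p q) = overlap q p"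
  by (simp add: overlap_def mult_ac)

lemma overlap_self: "p \<in> S2 \<Longrightarrow> overlap p p = 1"
proof -
  assume p: "p \<in> S2"
  have "(1 + p $ 3) / 2 + (1 - p $ 3) / 2 = 1" by (simp add: field_simps)
  then show ?thesis
    unfolding overlap_def spinor1_square[OF p] spinor2_square[OF p] of_real_add[symmetric] by simp
qed

lemma norm_diff_le_2: "p \<in> S2 \<Longrightarrow> q \<in> S2 \<Longrightarrow> norm (p - q) \<le> 2"
  using norm_triangle_ineq4[of p q] by simp

text \<open>The reproducing property of the kernels \<open>(overlap p q)\<^sup>m\<close> plays the role of the rotation
  invariance of \<open>\<nu>\<close> (Archimedes' hat-box theorem), which is thus never needed.\<close>

lemma integral_overlap_moment:
  assumes q: "q \<in> S2"
  shows "(\<integral>p. (1 - (norm (p - q))\<^sup>2 / 4) ^ m \<partial>sphere_area) = 4 * pi / real (m + 1)"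
proof -
  let ?b = "\<lambda>k. of_nat (m choose k) :: complex"
  let ?s = "spin_monomial m"
  let ?h = "\<lambda>k. complex_of_real (4 * pi / (real (m + 1) * real (m choose k)))"
  have expand: "complex_of_real ((1 - (norm (p - q))\<^sup>2 / 4) ^ m)
      = (\<Sum>k\<le>m. \<Sum>l\<le>m. (?b k * cnj (?s k q) * ?b l * ?s l q) * (?s k p * cnj (?s l p)))" if "p \<in> S2" for p
  proof -
    have "complex_of_real ((1 - (norm (p - q))\<^sup>2 / 4) ^ m) = overlap p q ^ m * cnj (overlap p q ^ m)"
      by (simp add: power_mult_distrib[symmetric] overlap_mult_cnj[OF that q] del: of_real_diff)
    also have "\<dots> = (\<Sum>k\<le>m. \<Sum>l\<le>m. (?b k * cnj (?s k q) * ?b l * ?s l q) * (?s k p * cnj (?s l p)))"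
      unfolding overlap_power cnj_sum sum_product
      by (intro sum.cong refl) (simp add: mult_ac)
    finally show ?thesis .
  qed
  have int: "integrable sphere_area (\<lambda>p. ?s k p * cnj (?s l p))" for k l
  proof (rule sphere_area.integrable_const_bound[where B = 1])
    show "AE p in sphere_area. cmod (?s k p * cnj (?s l p)) \<le> 1"
      by (rule AE_I2) (auto simp: norm_mult norm_spin_monomial_le intro!: mult_le_one)
  qed measurable
  have "complex_of_real (\<integral>p. (1 - (norm (p - q))\<^sup>2 / 4) ^ m \<partial>sphere_area)
      = (\<integral>p. (\<Sum>k\<le>m. \<Sum>l\<le>m. (?b k * cnj (?s k q) * ?b l * ?s l q) * (?s k p * cnj (?s l p))) \<partial>sphere_area)"
    unfolding integral_complex_of_real[symmetric]
    by (intro Bochner_Integration.integral_cong refl expand) simp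
  also have "\<dots> = (\<Sum>k\<le>m. \<Sum>l\<le>m. (?b k * cnj (?s k q) * ?b l * ?s l q)
      * (\<integral>p. ?s k p * cnj (?s l p) \<partial>sphere_area))"
    by (intro has_bochner_integral_integral_eq has_bochner_integral_sum has_bochner_integral_mult_right
        has_bochner_integral_integrable int)
  also have "\<dots> = (\<Sum>k\<le>m. \<Sum>l\<le>m. if k = l then (?b k * cnj (?s k q) * ?b l * ?s l q) * ?h k else 0)"
    by (intro sum.cong refl) (simp add: spin_monomial_orthogonal)
  also have "\<dots> = (\<Sum>k\<le>m. (?b k * cnj (?s k q) * ?b k * ?s k q) * ?h k)"
    by simp
  also have "\<dots> = (\<Sum>k\<le>m. of_real (4 * pi / real (m + 1)) * (?b k * ?s k q * cnj (?s k q)))"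
  proof (intro sum.cong refl)
    fix k assume "k \<in> {..m}"
    \<comment> \<open>One of the two binomial coefficients cancels against the norm; the other
      rebuilds \<open>overlap q q ^ m\<close>, which is 1.\<close>
    then have "?b k * ?h k = of_real (4 * pi / real (m + 1))"
      by (simp add: divide_simps)
    then have "(?b k * ?h k) * (?b k * ?s k q * cnj (?s k q))
        = of_real (4 * pi / real (m + 1)) * (?b k * ?s k q * cnj (?s k q))"
      by (rule arg_cong)
    then show "(?b k * cnj (?s k q) * ?b k * ?s k q) * ?h k
        = of_real (4 * pi / real (m + 1)) * (?b k * ?s k q * cnj (?s k q))"
      by (simp only: mult_ac)
  qed
  also have "\<dots> = of_real (4 * pi / real (m + 1)) * overlap q q ^ m"
    unfolding overlap_power by (simp add: sum_distrib_left)
  also have "\<dots> = of_real (4 * pi / real (m + 1))"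
    using q by (simp add: overlap_self)
  finally show ?thesis by (simp only: of_real_eq_iff)
qed

section \<open>The law of a pair of points\<close>

lemma has_bochner_integral_power_unit:
  "has_bochner_integral lborel (\<lambda>t. indicator {0..1} t * t ^ k) (1 / real (k + 1))"
proof -
  have "has_bochner_integral lborel (\<lambda>t. t ^ k * indicator {0..1} t)
      (1 ^ Suc k / real (Suc k) - 0 ^ Suc k / real (Suc k))"
    by (rule has_bochner_integral_FTC_Icc_real) (auto intro!: derivative_eq_intros simp del: power_Suc)
  then show ?thesis by (simp add: mult.commute)
qed

text \<open>The factor \<open>n / (n - 1)\<close> is the reciprocal of \<open>1 - 1 / n\<close>, the
  integral of \<open>1 - t ^ (n - 1)\<close> over the unit interval.\<close>

definition overlap_density :: "nat \<Rightarrow> real \<Rightarrow> real" where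
  "overlap_density n t = indicator {0..1} t * (real n / (real n - 1) * (1 - t ^ (n - 1)))"

lemma measurable_overlap_density [measurable]: "overlap_density n \<in> borel_measurable borel"
  unfolding overlap_density_def[abs_def] by measurable

lemma overlap_density_nonneg: "n \<ge> 2 \<Longrightarrow> 0 \<le> overlap_density n t"
  by (auto simp: overlap_density_def indicator_def power_le_one)

lemma overlap_density_moment:
  assumes "n \<ge> 2"
  shows "has_bochner_integral lborel (\<lambda>t. overlap_density n t * t ^ m)
    (real n / (real n - 1) * (1 / real (m + 1) - 1 / real (m + n)))"
proof -
  have "has_bochner_integral lborel
      (\<lambda>t. real n / (real n - 1) * (indicator {0..1} t * t ^ m - indicator {0..1} t * t ^ (m + n - 1)))
      (real n / (real n - 1) * (1 / real (m + 1) - 1 / real (m + n - 1 + 1)))"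
    by (intro has_bochner_integral_mult_right has_bochner_integral_diff has_bochner_integral_power_unit)
  moreover have "t ^ (m + n - 1) = t ^ (n - 1) * t ^ m" for t :: real
    using assms by (simp add: add.commute flip: power_add)
  moreover have "m + n - 1 + 1 = m + n" using assms by simp
  ultimately show ?thesis
    by (simp only: overlap_density_def right_diff_distrib left_diff_distrib mult_1_left mult_1_right mult_ac)
qed

lemma real_distribution_overlap_density:
  assumes "n \<ge> 2"
  shows "real_distribution (density lborel (overlap_density n))"
proof -
  have "has_bochner_integral lborel (overlap_density n) 1"
    using overlap_density_moment[OF assms, of 0] assms by (simp add: field_simps)
  then have "(\<integral>\<^sup>+t. ennreal (overlap_density n t) \<partial>lborel) = 1"
    using overlap_density_nonneg[OF assms]
    by (subst nn_integral_eq_integral) (auto simp: has_bochner_integral_iff)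
  then have "prob_space (density lborel (overlap_density n))"
    by (intro prob_spaceI) (simp add: emeasure_density)
  then show ?thesis
    by (simp add: real_distribution_def real_distribution_axioms_def)
qed

lemma sphere_pair_overlap_moment:
  "has_bochner_integral (sphere_area \<Otimes>\<^sub>M sphere_area) (\<lambda>x. (1 - (norm (fst x - snd x))\<^sup>2 / 4) ^ m)
     ((4 * pi)\<^sup>2 / real (m + 1))"
proof -
  interpret pair_sigma_finite sphere_area sphere_area by standard
  interpret MM: finite_measure "sphere_area \<Otimes>\<^sub>M sphere_area"
    by (intro finite_measure_pair_measure) unfold_locales
  let ?f = "\<lambda>x y :: real ^ 3. (1 - (norm (x - y))\<^sup>2 / 4) ^ m"
  have int: "integrable (sphere_area \<Otimes>\<^sub>M sphere_area) (\<lambda>(x, y). ?f x y)"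
  proof (rule MM.integrable_const_bound[where B = 1], rule AE_I2)
    fix z assume "z \<in> space (sphere_area \<Otimes>\<^sub>M sphere_area)"
    then have "norm (fst z - snd z) \<le> 2"
      by (intro norm_diff_le_2) (auto simp: space_pair_measure)
    then have "(norm (fst z - snd z))\<^sup>2 \<le> 2\<^sup>2" by (intro power_mono) auto
    then show "norm (case z of (x, y) \<Rightarrow> ?f x y) \<le> 1"
      by (auto simp: case_prod_beta power_abs abs_if intro!: power_le_one)
  qed measurable
  have "(\<integral>y. \<integral>x. ?f x y \<partial>sphere_area \<partial>sphere_area) = (\<integral>y. 4 * pi / real (m + 1) \<partial>sphere_area)"
    by (intro Bochner_Integration.integral_cong refl integral_overlap_moment) simp
  also have "\<dots> = (4 * pi)\<^sup>2 / real (m + 1)"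
    using emeasure_sphere_area_space by (simp add: measure_def power2_eq_square)
  finally show ?thesis
    using int integral_snd[OF int] by (simp add: has_bochner_integral_iff case_prod_unfold)
qed

lemma vandermonde_density_eq_det:
  fixes p :: "nat \<Rightarrow> real ^ 3"
  assumes "\<And>i. i < n \<Longrightarrow> p i \<in> S2"
  defines "D \<equiv> \<Sum>\<sigma> | \<sigma> permutes {..<n}. of_int (sign \<sigma>) * (\<Prod>r<n. spin_monomial (n - 1) (\<sigma> r) (p r))"
  shows "complex_of_real (\<Prod>j<n. \<Prod>i<j. (norm (p i - p j))\<^sup>2) = (\<Prod>j<n. 4 ^ j) * (D * cnj D)"
proof -
  let ?u = "\<lambda>i j. spinor1 (p i) * spinor2 (p j) - spinor1 (p j) * spinor2 (p i)"
  have "D = Determinant.det (mat n n (\<lambda>(i, k). spinor1 (p i) ^ (n - 1 - k) * spinor2 (p i) ^ k))"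
  proof -
    have "\<sigma> r < n" if "\<sigma> permutes {..<n}" "r < n" for \<sigma> r
      using permutes_in_image[OF that(1), of r] that(2) by simp
    then show ?thesis
      unfolding D_def det_def'[OF mat_carrier] atLeast0LessThan spin_monomial_def
      by (intro sum.cong prod.cong arg_cong2[where f = "(*)"] refl) auto
  qed
  then have D: "D = (\<Prod>j<n. \<Prod>i<j. ?u i j)"
    unfolding det_homogeneous_vandermonde .
  have "complex_of_real (\<Prod>j<n. \<Prod>i<j. (norm (p i - p j))\<^sup>2) = (\<Prod>j<n. \<Prod>i<j. 4 * (?u i j * cnj (?u i j)))"
    unfolding of_real_prod using assms(1) by (intro prod.cong refl chord_spinor) auto
  \<comment> \<open>There are j indices i < j, whence the factor \<open>4 ^ j\<close>.\<close>
  also have "\<dots> = (\<Prod>j<n. 4 ^ j) * (D * cnj D)"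
    unfolding D cnj_prod prod.distrib by simp
  finally show ?thesis .
qed

text \<open>The product of diagonal kernels is constant and gives \<open>1 / (m + 1)\<close>; the
  squared modulus of the off-diagonal kernel is a multiple of \<open>w ^ (n - 1)\<close> and shifts
  the exponent, giving \<open>1 / (m + n)\<close>. Moments are stated up to a common
  \<open>Z\<close> because the constant in the density of the ensemble is merely known to
  exist.\<close>

lemma spherical_pair_moments:
  assumes n: "n \<ge> 2"
  obtains Z :: real where "Z > 0"
    "\<And>i j m. i < n \<Longrightarrow> j < n \<Longrightarrow> i \<noteq> j \<Longrightarrow>
      (\<integral>x. (1 - (norm (x i - x j))\<^sup>2 / 4) ^ m * (\<Prod>j<n. \<Prod>i<j. (norm (x i - x j))\<^sup>2) \<partial>Pi\<^sub>M {..<n} (\<lambda>_. sphere_area))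
      = Z * (1 / real (m + 1) - 1 / real (m + n))"
proof -
  let ?\<Pi> = "Pi\<^sub>M {..<n} (\<lambda>_. sphere_area)"
  let ?V = "\<lambda>x :: nat \<Rightarrow> real ^ 3. \<Prod>j<n. \<Prod>i<j. (norm (x i - x j))\<^sup>2"
  let ?\<phi> = "spin_monomial (n - 1)"
  define h where "h k = 4 * pi / (real n * real (n - 1 choose k))" for k
  define D where "D x = (\<Sum>\<sigma> | \<sigma> permutes {..<n}. of_int (sign \<sigma>) * (\<Prod>r<n. ?\<phi> (\<sigma> r) (x r)))" for x
  define K where "K x y = (\<Sum>k<n. ?\<phi> k x * cnj (?\<phi> k y) / of_real (h k))" for x y
  define c :: real where "c = (\<Prod>j<n. 4 ^ j)"
  \<comment> \<open>\<open>c\<close> collects the factors 4 of the squared chords,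
    \<open>fact n\<close> and the product of the \<open>h k\<close> come from the determinantal
    formula, \<open>n^2\<close> is what remains of the kernel constants after integrating over two
    spheres, and the denominator undoes the averaging over pairs.\<close>
  define Z where "Z = c * (fact n * (\<Prod>k<n. h k)) * (real n)\<^sup>2 / real (n * (n - 1))"
  have h: "h k > 0" if "k < n" for k
    using that by (simp add: h_def)
  have K: "K x y = of_real (real n / (4 * pi)) * overlap x y ^ (n - 1)" for x y
    using spin_kernel[where N = "n - 1" and p = x and q = y] n
    by (simp add: K_def h_def lessThan_Suc_atMost[symmetric])
  have moments: "(\<integral>x. (1 - (norm (x i - x j))\<^sup>2 / 4) ^ m * ?V x \<partial>?\<Pi>) = Z * (1 / real (m + 1) - 1 / real (m + n))"
    if ij: "i < n" "j < n" "i \<noteq> j" for i j m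
  proof -
    let ?f = "\<lambda>x y :: real ^ 3. complex_of_real ((1 - (norm (x - y))\<^sup>2 / 4) ^ m)"
    have f_bound: "cmod (?f x y) \<le> 1" if "x \<in> S2" "y \<in> S2" for x y
    proof -
      have "(norm (x - y))\<^sup>2 \<le> 2\<^sup>2" using norm_diff_le_2[OF that] by (intro power_mono) auto
      then show ?thesis
        unfolding norm_of_real power_abs by (intro power_le_one) (auto simp: abs_if)
    qed
    have f_meas: "case_prod ?f \<in> borel_measurable (sphere_area \<Otimes>\<^sub>M sphere_area)" by measurable
    have det: "of_nat (n * (n - 1)) * (\<integral>x. ?f (x i) (x j) * (D x * cnj (D x)) \<partial>?\<Pi>)
        = fact n * (\<Prod>k<n. complex_of_real (h k)) * (\<integral>p. ?f (fst p) (snd p) *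
            (K (fst p) (fst p) * K (snd p) (snd p) - K (fst p) (snd p) * K (snd p) (fst p))
            \<partial>(sphere_area \<Otimes>\<^sub>M sphere_area))"
      unfolding D_def K_def
    proof (rule sphere_area.determinantal_pair_integral[where C = 1 and B = 1, OF ij f_meas])
      show "(\<integral>x. ?\<phi> k x * cnj (?\<phi> l x) \<partial>sphere_area) = (if k = l then complex_of_real (h k) else 0)"
        if "k < n" "l < n" for k l
        using that spin_monomial_orthogonal[of k "n - 1" l] by (simp add: h_def)
      show "complex_of_real (h k) \<noteq> 0" if "k < n" for k
        using h[OF that] by simp
    qed (use f_bound norm_spin_monomial_le in auto)
    have "(\<integral>p. ?f (fst p) (snd p) *
            (K (fst p) (fst p) * K (snd p) (snd p) - K (fst p) (snd p) * K (snd p) (fst p))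
            \<partial>(sphere_area \<Otimes>\<^sub>M sphere_area))
        = (\<integral>p. complex_of_real ((real n / (4 * pi))\<^sup>2 * ((1 - (norm (fst p - snd p))\<^sup>2 / 4) ^ m
            - (1 - (norm (fst p - snd p))\<^sup>2 / 4) ^ (m + n - 1))) \<partial>(sphere_area \<Otimes>\<^sub>M sphere_area))"
    proof (rule Bochner_Integration.integral_cong[OF refl])
      fix p assume "p \<in> space (sphere_area \<Otimes>\<^sub>M sphere_area)"
      then have p: "fst p \<in> S2" "snd p \<in> S2" by (auto simp: space_pair_measure)
      let ?w = "1 - (norm (fst p - snd p))\<^sup>2 / 4"
      have "K (fst p) (snd p) * K (snd p) (fst p)
          = of_real ((real n / (4 * pi))\<^sup>2) * (overlap (fst p) (snd p) * cnj (overlap (fst p) (snd p))) ^ (n - 1)"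
        unfolding K cnj_overlap by (simp add: power2_eq_square power_mult_distrib)
      also have "\<dots> = of_real ((real n / (4 * pi))\<^sup>2 * ?w ^ (n - 1))"
        unfolding overlap_mult_cnj[OF p] by (simp only: of_real_mult of_real_power)
      finally have cross: "K (fst p) (snd p) * K (snd p) (fst p) = \<dots>" .
      have diag: "K (fst p) (fst p) * K (snd p) (snd p) = of_real ((real n / (4 * pi))\<^sup>2)"
        unfolding K overlap_self[OF p(1)] overlap_self[OF p(2)] by (simp add: power2_eq_square)
      have "?w ^ (m + n - 1) = ?w ^ m * ?w ^ (n - 1)"
        using n by (simp flip: power_add)
      then show "?f (fst p) (snd p) *
            (K (fst p) (fst p) * K (snd p) (snd p) - K (fst p) (snd p) * K (snd p) (fst p))
          = complex_of_real ((real n / (4 * pi))\<^sup>2 * (?w ^ m - ?w ^ (m + n - 1)))"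
        unfolding diag cross of_real_diff[symmetric] of_real_mult[symmetric] of_real_eq_iff
        by (simp only: right_diff_distrib mult_ac mult_1_left mult_1_right)
    qed
    also have "\<dots> = complex_of_real ((real n / (4 * pi))\<^sup>2
        * ((4 * pi)\<^sup>2 / real (m + 1) - (4 * pi)\<^sup>2 / real (m + n - 1 + 1)))"
      unfolding integral_complex_of_real of_real_eq_iff
      by (intro has_bochner_integral_integral_eq has_bochner_integral_mult_right
          has_bochner_integral_diff sphere_pair_overlap_moment)
    also have "(real n / (4 * pi))\<^sup>2 * ((4 * pi)\<^sup>2 / real (m + 1) - (4 * pi)\<^sup>2 / real (m + n - 1 + 1))
        = (real n)\<^sup>2 * (1 / real (m + 1) - 1 / real (m + n))"
    proof -
      have "m + n - 1 + 1 = m + n" using n by simp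
      moreover have "(real n / (4 * pi))\<^sup>2 * (4 * pi)\<^sup>2 = (real n)\<^sup>2"
        by (simp add: power_divide)
      ultimately show ?thesis
        by (simp only: right_diff_distrib times_divide_eq_right mult_1_right)
    qed
    finally have pair: "(\<integral>p. ?f (fst p) (snd p) *
            (K (fst p) (fst p) * K (snd p) (snd p) - K (fst p) (snd p) * K (snd p) (fst p))
            \<partial>(sphere_area \<Otimes>\<^sub>M sphere_area)) = of_real ((real n)\<^sup>2 * (1 / real (m + 1) - 1 / real (m + n)))" .
    have "complex_of_real (\<integral>x. (1 - (norm (x i - x j))\<^sup>2 / 4) ^ m * ?V x \<partial>?\<Pi>)
        = (\<integral>x. of_real c * (?f (x i) (x j) * (D x * cnj (D x))) \<partial>?\<Pi>)"
      unfolding integral_complex_of_real[symmetric]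
    proof (rule Bochner_Integration.integral_cong[OF refl])
      fix x assume "x \<in> space ?\<Pi>"
      then have "x r \<in> S2" if "r < n" for r
        using that by (auto simp: space_PiM PiE_def)
      then have V: "complex_of_real (?V x) = of_real c * (D x * cnj (D x))"
        unfolding D_def using vandermonde_density_eq_det[of n x] by (simp add: c_def)
      show "complex_of_real ((1 - (norm (x i - x j))\<^sup>2 / 4) ^ m * ?V x)
          = of_real c * (?f (x i) (x j) * (D x * cnj (D x)))"
        unfolding of_real_mult V by (simp only: mult_ac)
    qed
    also have "\<dots> = of_real c * (\<integral>x. ?f (x i) (x j) * (D x * cnj (D x)) \<partial>?\<Pi>)"
      by (rule integral_mult_right_zero)
    finally have "of_nat (n * (n - 1)) * complex_of_real (\<integral>x. (1 - (norm (x i - x j))\<^sup>2 / 4) ^ m * ?V x \<partial>?\<Pi>)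
        = of_real c * (of_nat (n * (n - 1)) * (\<integral>x. ?f (x i) (x j) * (D x * cnj (D x)) \<partial>?\<Pi>))"
      by (simp only: mult_ac)
    also have "\<dots> = complex_of_real (c * (fact n * (\<Prod>k<n. h k) * ((real n)\<^sup>2 * (1 / real (m + 1) - 1 / real (m + n)))))"
      unfolding det pair by (simp only: of_real_mult of_real_prod of_real_fact)
    finally have "complex_of_real (real (n * (n - 1)) * (\<integral>x. (1 - (norm (x i - x j))\<^sup>2 / 4) ^ m * ?V x \<partial>?\<Pi>))
        = of_real (c * (fact n * (\<Prod>k<n. h k) * ((real n)\<^sup>2 * (1 / real (m + 1) - 1 / real (m + n)))))"
      by (simp only: of_real_mult of_real_of_nat_eq)
    then have "real (n * (n - 1)) * (\<integral>x. (1 - (norm (x i - x j))\<^sup>2 / 4) ^ m * ?V x \<partial>?\<Pi>)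
        = c * (fact n * (\<Prod>k<n. h k) * ((real n)\<^sup>2 * (1 / real (m + 1) - 1 / real (m + n))))"
      by (simp only: of_real_eq_iff)
    note prod_eq = this
    have div: "x = b / a" if "a * x = b" "a \<noteq> 0" for a b x :: real
      using that by auto
    have "(\<integral>x. (1 - (norm (x i - x j))\<^sup>2 / 4) ^ m * ?V x \<partial>?\<Pi>)
        = c * (fact n * (\<Prod>k<n. h k) * ((real n)\<^sup>2 * (1 / real (m + 1) - 1 / real (m + n)))) / real (n * (n - 1))"
      by (rule div[OF prod_eq]) (use n in simp)
    then show ?thesis
      unfolding Z_def by (simp only: times_divide_eq_left mult.assoc)
  qed
  have "Z > 0"
    unfolding Z_def c_def using n h by (intro divide_pos_pos mult_pos_pos prod_pos zero_less_power) auto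
  with moments show thesis using that by blast
qed

lemma spherical_ensemble_density_pair_law:
  assumes n: "n \<ge> 2" and ij: "i < n" "j < n" "i \<noteq> j"
  defines "V \<equiv> \<lambda>x :: nat \<Rightarrow> real ^ 3. \<Prod>j<n. \<Prod>i<j. (norm (x i - x j))\<^sup>2"
  assumes Q: "Q = density (Pi\<^sub>M {..<n} (\<lambda>_. sphere_area)) (\<lambda>x. ennreal (c * V x))" and "prob_space Q"
  shows "distr Q borel (\<lambda>x. 1 - (norm (x i - x j))\<^sup>2 / 4) = density lborel (overlap_density n)"
proof (rule bounded_moments_determine_distribution[where B = 1])
  let ?\<Pi> = "Pi\<^sub>M {..<n} (\<lambda>_. sphere_area)"
  let ?X = "\<lambda>x :: nat \<Rightarrow> real ^ 3. 1 - (norm (x i - x j))\<^sup>2 / 4"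
  interpret Q: prob_space Q by fact
  have V_nonneg: "0 \<le> V x" for x by (auto simp: V_def intro!: prod_nonneg)
  have comp [measurable]: "(\<lambda>x. x r) \<in> borel_measurable ?\<Pi>" if "r < n" for r
  proof -
    have "(\<lambda>x. x r) \<in> ?\<Pi> \<rightarrow>\<^sub>M sphere_borel"
      using measurable_component_singleton[of r "{..<n}" "\<lambda>_. sphere_area"] that
      by (simp cong: measurable_cong_sets)
    then show ?thesis by (rule measurable_compose[OF _ measurable_sphere_borel_ident])
  qed
  have V_meas [measurable]: "V \<in> borel_measurable ?\<Pi>"
    unfolding V_def by (intro borel_measurable_prod borel_measurable_power borel_measurable_norm
        borel_measurable_diff comp) auto
  have X_meas': "?X \<in> borel_measurable ?\<Pi>"
    using ij by measurable
  have X_meas [measurable]: "?X \<in> borel_measurable Q"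
    using X_meas' by (simp add: Q)
  \<comment> \<open>\<open>ennreal\<close> sends negative reals to 0, so a constant that is not
    positive would give the zero measure instead of a probability.\<close>
  have c: "c > 0"
  proof (rule ccontr)
    assume "\<not> c > 0"
    then have "ennreal (c * V x) = 0" for x
      using V_nonneg by (intro ennreal_neg mult_nonpos_nonneg) auto
    then have "emeasure Q (space Q) = 0" by (simp add: Q emeasure_density)
    then show False using Q.emeasure_space_1 by simp
  qed
  obtain Z where Z: "\<And>m. (\<integral>x. ?X x ^ m * V x \<partial>?\<Pi>) = Z * (1 / real (m + 1) - 1 / real (m + n))"
    by (rule spherical_pair_moments[OF n]) (rule that, use ij in \<open>simp only: V_def\<close>)
  have cZ: "(\<integral>x. ?X x ^ m \<partial>Q) = c * Z * (1 / real (m + 1) - 1 / real (m + n))" for m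
  proof -
    have "(\<integral>x. ?X x ^ m \<partial>Q) = (\<integral>x. (c * V x) *\<^sub>R ?X x ^ m \<partial>?\<Pi>)"
      unfolding Q using c V_nonneg X_meas' by (intro integral_density) auto
    also have "\<dots> = c * (\<integral>x. ?X x ^ m * V x \<partial>?\<Pi>)"
      by (simp flip: integral_mult_right_zero) (simp add: mult_ac)
    finally show ?thesis by (simp add: Z)
  qed
  \<comment> \<open>The zeroth moment is the total mass; it fixes the product of the two unknown
    constants.\<close>
  have "c * Z * (1 - 1 / real n) = 1"
    using cZ[of 0] Q.prob_space by simp
  then have cZ_eq: "c * Z = real n / (real n - 1)"
    using n by (simp add: field_simps)
  show "real_distribution (distr Q borel ?X)" by simp
  show "real_distribution (density lborel (overlap_density n))"
    by (rule real_distribution_overlap_density[OF n])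
  have "\<bar>?X x\<bar> \<le> 1" if "x \<in> space Q" for x
  proof -
    have "x i \<in> S2" "x j \<in> S2" using that ij by (auto simp: Q space_PiM PiE_def)
    then have "(norm (x i - x j))\<^sup>2 \<le> 2\<^sup>2" by (intro power_mono norm_diff_le_2) auto
    then show ?thesis by (auto simp: abs_if)
  qed
  then show "AE t in distr Q borel ?X. \<bar>t\<bar> \<le> 1"
    by (subst AE_distr_iff) auto
  show "AE t in density lborel (overlap_density n). \<bar>t\<bar> \<le> 1"
    by (subst AE_density) (auto simp: overlap_density_def indicator_def)
  fix m
  have "(\<integral>t. t ^ m \<partial>density lborel (overlap_density n)) = (\<integral>t. overlap_density n t *\<^sub>R t ^ m \<partial>lborel)"
    using overlap_density_nonneg[OF n] by (intro integral_density) auto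
  also have "\<dots> = real n / (real n - 1) * (1 / real (m + 1) - 1 / real (m + n))"
    using has_bochner_integral_integral_eq[OF overlap_density_moment[OF n, of m]] by simp
  also have "\<dots> = (\<integral>t. t ^ m \<partial>distr Q borel ?X)"
    by (subst integral_distr) (simp_all add: cZ cZ_eq)
  finally show "(\<integral>t. t ^ m \<partial>distr Q borel ?X) = (\<integral>t. t ^ m \<partial>density lborel (overlap_density n))" ..
qed

text \<open>The double sum is symmetric in the points, so its expectation over \<open>M\<close>
  equals that of the randomly relabelled tuple, whose law has the given density. \<open>g\<close>
  enters only through the law of a pair, the distance at t being \<open>2 * sqrt (1 - t)\<close>,
  and so may be unbounded.\<close>

lemma spherical_ensemble_pair_expectation:
  fixes g :: "real \<Rightarrow> real" and P :: "nat \<Rightarrow> 'a \<Rightarrow> real ^ 3"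
  assumes n: "n \<ge> 2" and ens: "spherical_ensemble n M P"
    and g [measurable]: "g \<in> borel_measurable borel"
    and v: "has_bochner_integral lborel (\<lambda>t. indicator {0..1} t * ((1 - t ^ (n - 1)) * g (2 * sqrt (1 - t)))) v"
  shows "has_bochner_integral M (\<lambda>\<omega>. \<Sum>i<n. \<Sum>j\<in>{..<n} - {i}. g (norm (P i \<omega> - P j \<omega>))) ((real n)\<^sup>2 * v)"
proof -
  let ?S = "{\<sigma>. \<sigma> permutes {..<n}}"
  let ?U = "uniform_count_measure ?S"
  let ?B = "Pi\<^sub>M {..<n} (\<lambda>_. sphere_borel)"
  let ?T = "\<lambda>(\<omega>, \<sigma>). \<lambda>i\<in>{..<n}. P (\<sigma> i) \<omega>"
  let ?V = "\<lambda>x :: nat \<Rightarrow> real ^ 3. \<Prod>j<n. \<Prod>i<j. (norm (x i - x j))\<^sup>2"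
  define E where "E x = (\<Sum>i<n. \<Sum>j\<in>{..<n} - {i}. g (norm (x i - x j)))" for x :: "nat \<Rightarrow> real ^ 3"
  interpret prob_space M using ens by (simp add: spherical_ensemble_def)
  have P [measurable]: "P i \<in> M \<rightarrow>\<^sub>M sphere_borel" if "i < n" for i
    using ens that by (simp add: spherical_ensemble_def)
  obtain c where c: "distr (M \<Otimes>\<^sub>M ?U) ?B ?T = density (Pi\<^sub>M {..<n} (\<lambda>_. sphere_area)) (\<lambda>x. ennreal (c * ?V x))"
    using ens unfolding spherical_ensemble_def by blast
  define Q where "Q = density (Pi\<^sub>M {..<n} (\<lambda>_. sphere_area)) (\<lambda>x. ennreal (c * ?V x))"
  have "?S \<noteq> {}" using permutes_id by blast
  then interpret U: prob_space ?U
    by (intro prob_space_uniform_count_measure finite_permutations finite_lessThan)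
  interpret MU: pair_prob_space M ?U ..
  have T: "?T \<in> M \<Otimes>\<^sub>M ?U \<rightarrow>\<^sub>M ?B"
    unfolding case_prod_unfold
  proof (rule measurable_restrict)
    fix i assume i: "i \<in> {..<n}"
    show "(\<lambda>x. P (snd x i) (fst x)) \<in> M \<Otimes>\<^sub>M ?U \<rightarrow>\<^sub>M sphere_borel"
    \<comment> \<open>The relabelling takes finitely many values, so joint measurability reduces to
      each fixed \<sigma>.\<close>
    proof (rule measurable_compose_countable'[where I = ?S and g = snd and f = "\<lambda>\<sigma> x. P (\<sigma> i) (fst x)"])
      show "(\<lambda>x. P (\<sigma> i) (fst x)) \<in> M \<Otimes>\<^sub>M ?U \<rightarrow>\<^sub>M sphere_borel" if "\<sigma> \<in> ?S" for \<sigma>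
      proof -
        have "\<sigma> i < n" using permutes_in_image[of \<sigma> "{..<n}" i] that i by simp
        then show ?thesis by measurable
      qed
      show "snd \<in> M \<Otimes>\<^sub>M ?U \<rightarrow>\<^sub>M count_space ?S" by measurable
    qed (simp add: countable_finite finite_permutations)
  qed
  have Q_distr: "Q = distr (M \<Otimes>\<^sub>M ?U) ?B ?T" unfolding Q_def c ..
  have Q_prob: "prob_space Q"
    unfolding Q_distr by (rule MU.prob_space_distr[OF T])
  have comp [measurable]: "(\<lambda>x. x r) \<in> borel_measurable ?B" if "r < n" for r
  proof -
    have "(\<lambda>x. x r) \<in> ?B \<rightarrow>\<^sub>M sphere_borel" using that by (intro measurable_component_singleton) auto
    then show ?thesis by (rule measurable_compose[OF _ measurable_sphere_borel_ident])
  qed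
  have [measurable_cong]: "sets Q = sets ?B" by (simp add: Q_distr)
  have pair: "has_bochner_integral Q (\<lambda>x. g (norm (x i - x j))) (real n / (real n - 1) * v)"
    if ij: "i < n" "j < n" "i \<noteq> j" for i j
  proof -
    let ?X = "\<lambda>x :: nat \<Rightarrow> real ^ 3. 1 - (norm (x i - x j))\<^sup>2 / 4"
    let ?F = "\<lambda>t. g (2 * sqrt (1 - t))"
    have X: "?X \<in> borel_measurable Q" using ij by measurable
    have "has_bochner_integral lborel (\<lambda>t. overlap_density n t *\<^sub>R ?F t) (real n / (real n - 1) * v)"
      using has_bochner_integral_mult_right[OF v, of "real n / (real n - 1)"]
      by (simp add: overlap_density_def mult_ac)
    then have "has_bochner_integral (density lborel (overlap_density n)) ?F (real n / (real n - 1) * v)"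
      using overlap_density_nonneg[OF n] by (intro has_bochner_integral_density) auto
    then have "has_bochner_integral (distr Q borel ?X) ?F (real n / (real n - 1) * v)"
      using spherical_ensemble_density_pair_law[OF n ij Q_def Q_prob] by simp
    then have "has_bochner_integral Q (\<lambda>x. ?F (?X x)) (real n / (real n - 1) * v)"
      using X by (simp add: has_bochner_integral_iff integrable_distr_eq integral_distr)
    moreover have "?F (?X x) = g (norm (x i - x j))" for x
      by (simp add: real_sqrt_divide)
    ultimately show ?thesis by simp
  qed
  have E_meas: "E \<in> borel_measurable ?B"
    unfolding E_def by (intro borel_measurable_sum measurable_compose[OF _ g] borel_measurable_norm
        borel_measurable_diff comp) auto
  have "has_bochner_integral Q E (\<Sum>i<n. \<Sum>j\<in>{..<n} - {i}. real n / (real n - 1) * v)"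
    unfolding E_def by (intro has_bochner_integral_sum pair) auto
  \<comment> \<open>The number \<open>n * (n - 1)\<close> of ordered pairs absorbs the denominator
    of the normalising factor.\<close>
  moreover have "(\<Sum>i<n. \<Sum>j\<in>{..<n} - {i}. real n / (real n - 1) * v) = (real n)\<^sup>2 * v"
    using n by (simp add: of_nat_diff power2_eq_square)
  ultimately have "has_bochner_integral (M \<Otimes>\<^sub>M ?U) (\<lambda>x. E (?T x)) ((real n)\<^sup>2 * v)"
    using T E_meas unfolding Q_distr by (simp add: has_bochner_integral_iff integrable_distr_eq integral_distr)
  moreover have "E (?T x) = E (\<lambda>i. P i (fst x))" if "x \<in> space (M \<Otimes>\<^sub>M ?U)" for x
  proof -
    have "snd x permutes {..<n}" using that by (auto simp: space_pair_measure space_uniform_count_measure)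
    from sum_off_diagonal_permute[OF this, of "\<lambda>i j. g (norm (P i (fst x) - P j (fst x)))"]
    show ?thesis by (simp add: E_def case_prod_unfold)
  qed
  ultimately have MU: "has_bochner_integral (M \<Otimes>\<^sub>M ?U) (\<lambda>x. E (\<lambda>i. P i (fst x))) ((real n)\<^sup>2 * v)"
    by (simp cong: has_bochner_integral_cong)
  have "(\<lambda>\<omega>. E (\<lambda>i. P i \<omega>)) \<in> borel_measurable M"
    unfolding E_def by (intro borel_measurable_sum measurable_compose[OF _ g] borel_measurable_norm
        borel_measurable_diff measurable_compose[OF P measurable_sphere_borel_ident]) auto
  \<comment> \<open>The integrand no longer depends on \<sigma>, and \<open>fst\<close> pushes the
    product with a probability measure forward to \<open>M\<close>.\<close>
  from has_bochner_integral_distr[OF this measurable_fst MU]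
  show ?thesis by (simp add: U.distr_pair_fst E_def)
qed

section \<open>Expected energies and their asymptotics\<close>

lemma expected_riesz_energy:
  assumes n: "n \<ge> 2" and ens: "spherical_ensemble n M P" and s: "s < 4"
  shows "has_bochner_integral M (\<lambda>\<omega>. riesz_energy s n (\<lambda>i. P i \<omega>))
    ((real n)\<^sup>2 * (2 powr (- s) * (\<Sum>j<n - 1. Beta (real j + 1) (2 - s / 2))))"
  unfolding riesz_energy_def
proof (rule spherical_ensemble_pair_expectation[OF n ens])
  have "AE t in lborel. 2 powr (- s) * (indicator {0..1} t * ((1 - t ^ (n - 1)) * (1 - t) powr (- s / 2)))
      = indicator {0..1} t * ((1 - t ^ (n - 1)) * (1 / (2 * sqrt (1 - t)) powr s))"
    using AE_lborel_singleton[of "1::real"]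
  proof eventually_elim
    case (elim t)
    show ?case
    proof (cases "t < 1")
      case True
      then have "(2 * sqrt (1 - t)) powr s = 2 powr s * (1 - t) powr (s / 2)"
        by (simp add: powr_mult powr_half_sqrt[symmetric] powr_powr)
      then show ?thesis by (simp add: powr_minus_divide)
    qed (use elim in auto)
  qed
  \<comment> \<open>The sum of Beta values is kept unevaluated because this form also covers s = 2,
    where the telescoped one has a pole.\<close>
  with has_bochner_integral_mult_right[OF has_bochner_integral_riesz_sum[OF s, of "n - 1"], of "2 powr (- s)"]
  show "has_bochner_integral lborel
      (\<lambda>t. indicator {0..1} t * ((1 - t ^ (n - 1)) * (1 / (2 * sqrt (1 - t)) powr s)))
      (2 powr (- s) * (\<Sum>j<n - 1. Beta (real j + 1) (2 - s / 2)))"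
    by (subst has_bochner_integral_cong_AE[symmetric]) auto
qed measurable

lemma expected_log_energy:
  assumes n: "n \<ge> 2" and ens: "spherical_ensemble n M P"
  shows "has_bochner_integral M (\<lambda>\<omega>. log_energy n (\<lambda>i. P i \<omega>))
    ((real n)\<^sup>2 * (- ln 2 * (1 - 1 / real n) - (harm n / n - 1) / 2))"
  unfolding log_energy_def
proof (rule spherical_ensemble_pair_expectation[OF n ens])
  have "has_bochner_integral lborel
      (\<lambda>t. - ln 2 * (indicator {0..1} t * t ^ 0 - indicator {0..1} t * t ^ (n - 1))
        - indicator {0..1} t * ((1 - t ^ (n - 1)) * ln (1 - t)) / 2)
      (- ln 2 * (1 / real (0 + 1) - 1 / real (n - 1 + 1)) - (harm n / n - 1) / 2)"
    using n by (intro has_bochner_integral_diff has_bochner_integral_mult_right has_bochner_integral_divide_zero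
        has_bochner_integral_power_unit has_bochner_integral_log) auto
  moreover have "AE t in lborel. - ln 2 * (indicator {0..1} t * t ^ 0 - indicator {0..1} t * t ^ (n - 1))
        - indicator {0..1} t * ((1 - t ^ (n - 1)) * ln (1 - t)) / 2
      = indicator {0..1} t * ((1 - t ^ (n - 1)) * ln (1 / (2 * sqrt (1 - t))))"
    using AE_lborel_singleton[of "1::real"]
  proof eventually_elim
    case (elim t)
    show ?case
    proof (cases "t < 1")
      case True
      then have ln: "ln (1 / (2 * sqrt (1 - t))) = - ln 2 - ln (1 - t) / 2"
        by (simp add: ln_div ln_mult ln_sqrt)
      show ?thesis
        unfolding ln by (cases "t \<in> {0..1}") (simp_all add: field_simps)
    qed (use elim in auto)
  qed
  ultimately show "has_bochner_integral lborel
      (\<lambda>t. indicator {0..1} t * ((1 - t ^ (n - 1)) * ln (1 / (2 * sqrt (1 - t)))))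
      (- ln 2 * (1 - 1 / real n) - (harm n / n - 1) / 2)"
    using n by (subst has_bochner_integral_cong_AE[symmetric]) (auto simp: of_nat_diff)
qed measurable

theorem theorem1p3:
  fixes M :: "nat \<Rightarrow> 'a measure"
    and P :: "nat \<Rightarrow> nat \<Rightarrow> 'a \<Rightarrow> real ^ 3"
  assumes "\<And>n. n \<ge> 2 \<Longrightarrow> spherical_ensemble n (M n) (P n)"
  shows
    "((\<forall>n\<ge>2. integrable (M n) (\<lambda>\<omega>. log_energy n (\<lambda>i. P n i \<omega>))) \<and>
      (\<lambda>n. (\<integral>\<omega>. log_energy n (\<lambda>i. P n i \<omega>) \<partial>M n)
           - ((1 / 2 - ln 2) * (real n)\<^sup>2 - 1 / 2 * real n * ln (real n)
              + (ln 2 - euler_mascheroni / 2) * real n - 1 / 4))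
        \<in> O(\<lambda>n. 1 / real n)) \<and>
     (\<forall>n\<ge>2. \<forall>s<4. s \<noteq> 2 \<longrightarrow>
        integrable (M n) (\<lambda>\<omega>. riesz_energy s n (\<lambda>i. P n i \<omega>)) \<and>
        (\<integral>\<omega>. riesz_energy s n (\<lambda>i. P n i \<omega>) \<partial>M n) =
          2 powr (1 - s) / (2 - s) * (real n)\<^sup>2
          - Gamma (real n) * Gamma (1 - s / 2) / (2 powr s * Gamma (real n + 1 - s / 2))
              * (real n)\<^sup>2) \<and>
     ((\<forall>n\<ge>2. integrable (M n) (\<lambda>\<omega>. riesz_energy 2 n (\<lambda>i. P n i \<omega>))) \<and>
      (\<lambda>n. (\<integral>\<omega>. riesz_energy 2 n (\<lambda>i. P n i \<omega>) \<partial>M n)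
           - (1 / 4 * (real n)\<^sup>2 * ln (real n) + euler_mascheroni / 4 * (real n)\<^sup>2
              - real n / 8 - 1 / 48))
        \<in> O(\<lambda>n. 1 / (real n)\<^sup>2))"
proof (intro conjI allI impI)
  note log = expected_log_energy[OF _ assms]
  note riesz = expected_riesz_energy[OF _ assms]
  fix n :: nat assume n: "n \<ge> 2"
  show "integrable (M n) (\<lambda>\<omega>. log_energy n (\<lambda>i. P n i \<omega>))"
    using log[OF n n] by (simp add: has_bochner_integral_iff)
  show "integrable (M n) (\<lambda>\<omega>. riesz_energy 2 n (\<lambda>i. P n i \<omega>))"
    using riesz[OF n n, of 2] by (simp add: has_bochner_integral_iff)
  fix s :: real assume s: "s < 4" "s \<noteq> 2"
  show "integrable (M n) (\<lambda>\<omega>. riesz_energy s n (\<lambda>i. P n i \<omega>))"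
    using riesz[OF n n s(1)] by (simp add: has_bochner_integral_iff)
  \<comment> \<open>For c = 1 - s/2, the conditions \<open>s < 4\<close> and
    \<open>s \<noteq> 2\<close> are \<open>c > -1\<close> and \<open>c \<noteq> 0\<close>. With n -
    1 terms the last Beta value has first argument \<open>real (n - 1) + 1 = real n\<close>.\<close>
  have "(\<Sum>j<n - 1. Beta (real j + 1) (2 - s / 2)) = 1 / (1 - s / 2) - Beta (real n) (1 - s / 2)"
    using sum_Beta_telescope[of "1 - s / 2" "n - 1"] s n by (simp add: of_nat_diff)
  moreover have "2 powr (- s) / (1 - s / 2) = 2 powr (1 - s) / (2 - s)"
    using s by (simp add: powr_diff powr_minus_divide field_simps)
  moreover have "2 powr (- s) * Beta (real n) (1 - s / 2)
      = Gamma (real n) * Gamma (1 - s / 2) / (2 powr s * Gamma (real n + 1 - s / 2))"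
    by (simp add: Beta_def powr_minus_divide add_diff_eq)
  ultimately have val: "2 powr (- s) * (\<Sum>j<n - 1. Beta (real j + 1) (2 - s / 2))
      = 2 powr (1 - s) / (2 - s)
        - Gamma (real n) * Gamma (1 - s / 2) / (2 powr s * Gamma (real n + 1 - s / 2))"
    by (simp add: right_diff_distrib)
  show "(\<integral>\<omega>. riesz_energy s n (\<lambda>i. P n i \<omega>) \<partial>M n) =
          2 powr (1 - s) / (2 - s) * (real n)\<^sup>2
          - Gamma (real n) * Gamma (1 - s / 2) / (2 powr s * Gamma (real n + 1 - s / 2))
              * (real n)\<^sup>2"
    unfolding has_bochner_integral_integral_eq[OF riesz[OF n n s(1)]] val
    by (simp only: right_diff_distrib mult.commute)
next
  define r where "r n = harm n - (ln (real n) + euler_mascheroni + 1 / (2 * real n) - 1 / (12 * (real n)\<^sup>2))" for n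
  have r: "0 \<le> r n" "r n \<le> 1 / real n ^ 4" if "n \<ge> 2" for n
    using harm_expansion_bounds[of n] that by (auto simp: r_def)
  have harm: "harm n = r n + ln (real n) + euler_mascheroni + 1 / (2 * real n) - 1 / (12 * (real n)\<^sup>2)" for n
    by (simp add: r_def)
  show "(\<lambda>n. (\<integral>\<omega>. log_energy n (\<lambda>i. P n i \<omega>) \<partial>M n)
           - ((1 / 2 - ln 2) * (real n)\<^sup>2 - 1 / 2 * real n * ln (real n)
              + (ln 2 - euler_mascheroni / 2) * real n - 1 / 4))
        \<in> O(\<lambda>n. 1 / real n)"
  proof (rule bigoI[where c = 1], rule eventually_mono[OF eventually_ge_at_top[of 2]])
    fix n :: nat assume n: "n \<ge> 2"
    have "(\<integral>\<omega>. log_energy n (\<lambda>i. P n i \<omega>) \<partial>M n)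
        = (real n)\<^sup>2 * (- ln 2 * (1 - 1 / real n) - (harm n / n - 1) / 2)"
      by (rule has_bochner_integral_integral_eq[OF expected_log_energy[OF n assms[OF n]]])
    \<comment> \<open>The harmonic number enters as \<open>- n * harm n / 2\<close>: its term 1/(2n)
      yields the constant -1/4, and its term -1/(12 n^2) the leading error 1/(24 n).\<close>
    also have "\<dots> - ((1 / 2 - ln 2) * (real n)\<^sup>2 - 1 / 2 * real n * ln (real n)
              + (ln 2 - euler_mascheroni / 2) * real n - 1 / 4) = 1 / (24 * real n) - real n * r n / 2"
      unfolding harm using n by (simp add: field_simps power2_eq_square)
    finally have eq: "(\<integral>\<omega>. log_energy n (\<lambda>i. P n i \<omega>) \<partial>M n)
           - ((1 / 2 - ln 2) * (real n)\<^sup>2 - 1 / 2 * real n * ln (real n)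
              + (ln 2 - euler_mascheroni / 2) * real n - 1 / 4) = 1 / (24 * real n) - real n * r n / 2" .
    have "real n * r n \<le> real n * (1 / real n ^ 4)"
      using r[OF n] by (intro mult_left_mono) auto
    also have "\<dots> = 1 / real n ^ 3"
      using n by (simp add: field_simps eval_nat_numeral)
    also have "\<dots> \<le> 1 / real n"
      using n power_increasing[of 1 3 "real n"] by (intro divide_left_mono) auto
    finally have "real n * r n \<le> 1 / real n" .
    moreover have "0 \<le> real n * r n" using r[OF n] by simp
    moreover have "1 / (24 * real n) = (1 / 24) * (1 / real n)" "0 \<le> 1 / real n" by simp_all
    ultimately have "\<bar>1 / (24 * real n) - real n * r n / 2\<bar> \<le> 1 / real n"
      by linarith
    then show "norm ((\<integral>\<omega>. log_energy n (\<lambda>i. P n i \<omega>) \<partial>M n)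
           - ((1 / 2 - ln 2) * (real n)\<^sup>2 - 1 / 2 * real n * ln (real n)
              + (ln 2 - euler_mascheroni / 2) * real n - 1 / 4)) \<le> 1 * norm (1 / real n)"
      unfolding eq by simp
  qed
  show "(\<lambda>n. (\<integral>\<omega>. riesz_energy 2 n (\<lambda>i. P n i \<omega>) \<partial>M n)
           - (1 / 4 * (real n)\<^sup>2 * ln (real n) + euler_mascheroni / 4 * (real n)\<^sup>2
              - real n / 8 - 1 / 48))
        \<in> O(\<lambda>n. 1 / (real n)\<^sup>2)"
  proof (rule bigoI[where c = 1], rule eventually_mono[OF eventually_ge_at_top[of 2]])
    fix n :: nat assume n: "n \<ge> 2"
    then obtain m where m: "n = Suc m" by (cases n) auto
    have "(\<integral>\<omega>. riesz_energy 2 n (\<lambda>i. P n i \<omega>) \<partial>M n)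
        = (real n)\<^sup>2 * (2 powr (- 2) * (\<Sum>j<n - 1. Beta (real j + 1) (2 - 2 / 2)))"
      by (rule has_bochner_integral_integral_eq[OF expected_riesz_energy[OF n assms[OF n]]]) simp
    \<comment> \<open>At s = 2 the second Beta argument is 1, and the n - 1 terms add up to the
      harmonic number of n - 1, rewritten so that the expansion at n applies.\<close>
    also have "\<dots> = (real n)\<^sup>2 / 4 * (harm n - 1 / real n)"
      using sum_Beta_one[of "n - 1"] by (simp add: m harm_Suc powr_minus_divide inverse_eq_divide)
    \<comment> \<open>The terms 1/(2n) - 1/n and -1/(12 n^2) account exactly for -n/8 and -1/48, so
      the error is a multiple of the remainder \<open>r n\<close> alone.\<close>
    also have "\<dots> - (1 / 4 * (real n)\<^sup>2 * ln (real n) + euler_mascheroni / 4 * (real n)\<^sup>2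
              - real n / 8 - 1 / 48) = (real n)\<^sup>2 * r n / 4"
      unfolding harm using n by (simp add: field_simps power2_eq_square)
    finally have eq: "(\<integral>\<omega>. riesz_energy 2 n (\<lambda>i. P n i \<omega>) \<partial>M n)
           - (1 / 4 * (real n)\<^sup>2 * ln (real n) + euler_mascheroni / 4 * (real n)\<^sup>2
              - real n / 8 - 1 / 48) = (real n)\<^sup>2 * r n / 4" .
    have "(real n)\<^sup>2 * r n \<le> (real n)\<^sup>2 * (1 / real n ^ 4)"
      using r[OF n] by (intro mult_left_mono) auto
    also have "\<dots> = 1 / (real n)\<^sup>2"
      using n by (simp add: field_simps eval_nat_numeral)
    finally have "(real n)\<^sup>2 * r n \<le> 1 / (real n)\<^sup>2" .
    moreover have "0 \<le> (real n)\<^sup>2 * r n" using r[OF n] by simp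
    ultimately have "\<bar>(real n)\<^sup>2 * r n / 4\<bar> \<le> 1 / (real n)\<^sup>2"
      by linarith
    then show "norm ((\<integral>\<omega>. riesz_energy 2 n (\<lambda>i. P n i \<omega>) \<partial>M n)
           - (1 / 4 * (real n)\<^sup>2 * ln (real n) + euler_mascheroni / 4 * (real n)\<^sup>2
              - real n / 8 - 1 / 48)) \<le> 1 * norm (1 / (real n)\<^sup>2)"
      unfolding eq by simp
  qed
qed

end
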